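(* Let $k\ge2$ and $f\in\mathcal L_k$. Suppose there exists a probability measure $m$ on $E$ equivalent to $\mu$, with $\psi=d\mu/dm\in(0,\infty)$ $m$-a.e., such that $$L^\alpha\ln^{k-1}L\bigl(f\cdot(\psi^{\otimes k})^{1/\alpha},\,m\bigr)<\infty .$$ Then $I_k^e(f)<\infty$ a.s.
   Context: $\mathbb Z_+=\{1,2,\dots\}$, $\alpha\in(0,\infty)$, $\bigvee$ denotes supremum. $(E,\mathcal E)$ is a Borel space (there is a measurable bijection, with measurable inverse, onto a Borel subset of $[0,1]$) and $\mu$ is a nonzero $\sigma$-finite measure on it. Notation: $\ln_+x=\ln(x\vee1)$. For a measure $\nu$ on $E$ and measurable $h:E^k\to[0,\infty]$, $L^\alpha\ln^{k-1}L(h,\nu)=\int_{E^k}h^\alpha(\boldsymbol u)\bigl(1+(\ln_+h(\boldsymbol u))^{k-1}\bigr)\nu^k(d\boldsymbol u)$. $\psi^{\otimes k}(x_1,\dots,x_k)=\psi(x_1)\cdots\psi(x_k)$. $M_\alpha=(M_\alpha(A))_{A\in\mathcal E}$ is an independently scattered $\alpha$-Fréchet random sup measure with control measure $\mu$: $[0,\infty]$-valued random variables such that (i) $M_\alpha(A_1),\dots,M_\alpha(A_n)$ are independent for disjoint $A_i\in\mathcal E$; (ii) $\mathbb P(M_\alpha(A)\le x)=\exp\{-\mu(A)x^{-\alpha}\}$, $x\in(0,\infty)$ (so $M_\alpha(A)=\infty$ a.s. if $\mu(A)=\infty$); (iii) $M_\alpha(\bigcup_{j\ge1}A_j)=\bigvee_{j\ge1}M_\alpha(A_j)$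 a.s. for $A_j\in\mathcal E$. Off-diagonal space: $D^{(k)}=\{(x_1,\dots,x_k)\in E^k:x_i=x_j\text{ for some }i\ne j\}$, $E^{(k)}=E^k\setminus D^{(k)}$, $\mathcal E^{(k)}=\{A\cap E^{(k)}:A\in\mathcal E^k\}$. $\mathcal L_k$ is the class of measurable $f:E^k\to[0,\infty]$ vanishing on $D^{(k)}$. Product random sup measure $M_\alpha^{(k)}$ on $\mathcal E^{(k)}$: when the control measure is finite, $M_\alpha^{(k)}(A_1\times\cdots\times A_k)=M_\alpha(A_1)\cdots M_\alpha(A_k)$ for pairwise disjoint $A_i\in\mathcal E$; $M_\alpha^{(k)}(\bigcup_{i=1}^mB_i)=\bigvee_{i=1}^mM_\alpha^{(k)}(B_i)$ for such off-diagonal rectangles $B_i$; and for $A\in\mathcal E^{(k)}$, $M_\alpha^{(k)}(A)$ is the $L^\gamma$-limit ($\gamma\in(0,\alpha)$) of $M_\alpha^{(k)}(A_n)$ for finite unions $A_n$ of off-diagonal rectangles with $\mu^k(A_n\Delta A)\to0$. For $\sigma$-finite $\mu$, take $E_n\uparrow E$ with $\mu(E_n)\in(0,\infty)$, let $M_{\alpha,E_n}(\cdot)=M_\alpha(\cdot\cap E_n)$ and $M_\alpha^{(k)}(A)=\bigvee_nM_{\alpha,E_n}^{(k)}(A)$. All of this is a.s. independent of choices. Multiple extremal integral: for simple $f=\sum_{i=1}^Na_i\mathbf 1_{A_i}$ with $a_i\in(0,\infty)$ and disjoint $A_i\in\mathcal E^{(k)}$, $I_k^e(f)=\bigvee_{i=1}^Na_iM_\alpha^{(k)}(A_i)$.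 For $f\in\mathcal L_k$, $I_k^e(f)$ is the a.s. limit of $I_k^e(f_n)$ for any such simple $f_n\le f_{n+1}$ with $f_n\to f$ $\mu^k$-a.e. (a.s. independent of the choice). Equivalently in law (LePage representation), jointly over $f\in\mathcal L_k$ and $k\in\mathbb Z_+$ and for any probability measure $m$ equivalent to $\mu$ with $\psi=d\mu/dm\in(0,\infty)$ $m$-a.e., $I_k^e(f)\overset d=\bigvee_{\boldsymbol j}f(T_{j_1},\dots,T_{j_k})\prod_{r=1}^k\Gamma_{j_r}^{-1/\alpha}\psi(T_{j_r})^{1/\alpha}$, the supremum being over $\boldsymbol j\in\mathbb Z_+^k$ with distinct entries, $(\Gamma_i)$ the arrival times of a standard Poisson process, and $(T_i)$ i.i.d. with law $m$ independent of $(\Gamma_i)$. *)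

theory Defs
  imports "HOL-Probability.Probability"
begin

definition borel_isomorphic_to_unit_subset :: "'e measure \<Rightarrow> bool" where
  "borel_isomorphic_to_unit_subset M \<longleftrightarrow>
     (\<exists>B \<phi>. B \<in> sets (borel :: real measure) \<and> B \<subseteq> {0..1} \<and>
        bij_betw \<phi> (space M) B \<and>
        \<phi> \<in> M \<rightarrow>\<^sub>M restrict_space borel B \<and>
        inv_into (space M) \<phi> \<in> restrict_space borel B \<rightarrow>\<^sub>M M)"

text \<open>Powers are only used with a positive exponent, so \<open>0\<close> and \<open>\<infinity>\<close> are fixed points.\<close>

definition ennreal_powr :: "ennreal \<Rightarrow> real \<Rightarrow> ennreal" where
  "ennreal_powr x p = (if x = \<infinity> then \<infinity> else ennreal (enn2real x powr p))"

definition ln_plus :: "ennreal \<Rightarrow> ennreal" where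
  "ln_plus x = (if x = \<infinity> then \<infinity> else ennreal (ln (max (enn2real x) 1)))"

text \<open>\<open>E^k\<close> is modelled by the extensional functions on \<open>{..<k}\<close>, and \<open>\<nu>^k\<close> by the
  product measure on them.\<close>

abbreviation power_measure :: "nat \<Rightarrow> 'e measure \<Rightarrow> (nat \<Rightarrow> 'e) measure" where
  "power_measure k \<nu> \<equiv> Pi\<^sub>M {..<k} (\<lambda>_. \<nu>)"

definition L_ln_L :: "real \<Rightarrow> nat \<Rightarrow> ((nat \<Rightarrow> 'e) \<Rightarrow> ennreal) \<Rightarrow> 'e measure \<Rightarrow> ennreal" where
  "L_ln_L \<alpha> k h \<nu> =
     (\<integral>\<^sup>+ u. ennreal_powr (h u) \<alpha> * (1 + ln_plus (h u) ^ (k - 1)) \<partial>power_measure k \<nu>)"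

definition tensor_power :: "nat \<Rightarrow> ('e \<Rightarrow> ennreal) \<Rightarrow> (nat \<Rightarrow> 'e) \<Rightarrow> ennreal" where
  "tensor_power k \<psi> u = (\<Prod>i<k. \<psi> (u i))"

definition diagonal :: "nat \<Rightarrow> 'e measure \<Rightarrow> (nat \<Rightarrow> 'e) set" where
  "diagonal k M = {u \<in> space (power_measure k M). \<exists>i<k. \<exists>j<k. i \<noteq> j \<and> u i = u j}"

definition off_diagonal :: "nat \<Rightarrow> 'e measure \<Rightarrow> (nat \<Rightarrow> 'e) measure" where
  "off_diagonal k M =
     restrict_space (power_measure k M) (space (power_measure k M) - diagonal k M)"

definition class_L :: "nat \<Rightarrow> 'e measure \<Rightarrow> ((nat \<Rightarrow> 'e) \<Rightarrow> ennreal) set" where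
  "class_L k M = {f \<in> borel_measurable (power_measure k M). \<forall>u\<in>diagonal k M. f u = 0}"

text \<open>Independently scattered \<open>\<alpha>\<close>-Frechet random sup measure \<open>X\<close> with control measure \<open>\<mu>\<close>.
  For \<open>\<mu>(A) = \<infinity>\<close> the distribution function vanishes on \<open>(0, \<infinity>)\<close>.\<close>

definition frechet_sup_measure ::
  "'w measure \<Rightarrow> 'e measure \<Rightarrow> real \<Rightarrow> ('e set \<Rightarrow> 'w \<Rightarrow> ennreal) \<Rightarrow> bool" where
  "frechet_sup_measure P \<mu> \<alpha> X \<longleftrightarrow>
     (\<forall>A\<in>sets \<mu>. X A \<in> borel_measurable P) \<and>
     (\<forall>n (A :: nat \<Rightarrow> 'e set). (\<forall>i<n. A i \<in> sets \<mu>) \<longrightarrow> disjoint_family_on A {..<n} \<longrightarrow>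
        prob_space.indep_vars P (\<lambda>_. borel) (\<lambda>i. X (A i)) {..<n}) \<and>
     (\<forall>A\<in>sets \<mu>. \<forall>x>0. measure P {w \<in> space P. X A w \<le> ennreal x} =
        (if emeasure \<mu> A = \<infinity> then 0 else exp (- measure \<mu> A * x powr (- \<alpha>)))) \<and>
     (\<forall>A :: nat \<Rightarrow> 'e set. (\<forall>j. A j \<in> sets \<mu>) \<longrightarrow>
        (AE w in P. X (\<Union>j. A j) w = (SUP j. X (A j) w)))"

definition off_diagonal_rectangle :: "nat \<Rightarrow> 'e measure \<Rightarrow> (nat \<Rightarrow> 'e) set \<Rightarrow> bool" where
  "off_diagonal_rectangle k M R \<longleftrightarrow>
     (\<exists>A :: nat \<Rightarrow> 'e set. (\<forall>i<k. A i \<in> sets M) \<and> disjoint_family_on A {..<k} \<and> R = Pi\<^sub>E {..<k} A)"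

definition finite_rectangle_union :: "nat \<Rightarrow> 'e measure \<Rightarrow> (nat \<Rightarrow> 'e) set \<Rightarrow> bool" where
  "finite_rectangle_union k M C \<longleftrightarrow>
     (\<exists>n (B :: nat \<Rightarrow> (nat \<Rightarrow> 'e) set). (\<forall>i<n. off_diagonal_rectangle k M (B i)) \<and> C = (\<Union>i<n. B i))"

text \<open>Subtraction on \<open>ennreal\<close> truncates at \<open>0\<close>, so the sum below is \<open>|Y n - Z|\<close>. It is
  \<open>\<infinity>\<close> if \<open>Z\<close> is infinite; the limits that occur are a.s. finite.\<close>

definition L_limit :: "'w measure \<Rightarrow> real \<Rightarrow> (nat \<Rightarrow> 'w \<Rightarrow> ennreal) \<Rightarrow> ('w \<Rightarrow> ennreal) \<Rightarrow> bool" where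
  "L_limit P \<gamma> Y Z \<longleftrightarrow>
     (\<lambda>n. \<integral>\<^sup>+ w. ennreal_powr ((Y n w - Z w) + (Z w - Y n w)) \<gamma> \<partial>P) \<longlonglongrightarrow> 0"

text \<open>The following three predicates say that a family of random variables (resp. a random
  variable) has been produced by the construction of the product random sup measure (resp. of
  the multiple extremal integral) for some choice of the approximating or exhausting sequence.
  The result is a.s. independent of the choice; a hypothesis that merely asks for one choice
  therefore covers every version of the object.\<close>

definition product_sup_measure_finite ::
  "'w measure \<Rightarrow> 'e measure \<Rightarrow> real \<Rightarrow> nat \<Rightarrow> ('e set \<Rightarrow> 'w \<Rightarrow> ennreal) \<Rightarrow>
   ((nat \<Rightarrow> 'e) set \<Rightarrow> 'w \<Rightarrow> ennreal) \<Rightarrow> bool" where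
  "product_sup_measure_finite P \<nu> \<alpha> k X Y \<longleftrightarrow>
     (\<forall>A\<in>sets (off_diagonal k \<nu>). Y A \<in> borel_measurable P) \<and>
     (\<forall>A :: nat \<Rightarrow> 'e set. (\<forall>i<k. A i \<in> sets \<nu>) \<longrightarrow> disjoint_family_on A {..<k} \<longrightarrow>
        (AE w in P. Y (Pi\<^sub>E {..<k} A) w = (\<Prod>i<k. X (A i) w))) \<and>
     (\<forall>n (B :: nat \<Rightarrow> (nat \<Rightarrow> 'e) set). (\<forall>i<n. off_diagonal_rectangle k \<nu> (B i)) \<longrightarrow>
        (AE w in P. Y (\<Union>i<n. B i) w = (SUP i\<in>{..<n}. Y (B i) w))) \<and>
     (\<forall>A\<in>sets (off_diagonal k \<nu>). \<exists>C :: nat \<Rightarrow> (nat \<Rightarrow> 'e) set.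
        (\<forall>n. finite_rectangle_union k \<nu> (C n)) \<and>
        (\<lambda>n. emeasure (power_measure k \<nu>) (sym_diff (C n) A)) \<longlonglongrightarrow> 0 \<and>
        (\<forall>\<gamma>. 0 < \<gamma> \<longrightarrow> \<gamma> < \<alpha> \<longrightarrow> L_limit P \<gamma> (\<lambda>n. Y (C n)) (Y A)))"

text \<open>The measure \<open>density \<mu> (indicator (E n))\<close> is \<open>\<mu>(\<cdot> \<inter> E n)\<close>, the control measure of the
  restricted random sup measure. A finite \<open>\<mu>\<close> is covered by constant \<open>E\<close>.\<close>

definition product_sup_measure ::
  "'w measure \<Rightarrow> 'e measure \<Rightarrow> real \<Rightarrow> nat \<Rightarrow> ('e set \<Rightarrow> 'w \<Rightarrow> ennreal) \<Rightarrow>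
   ((nat \<Rightarrow> 'e) set \<Rightarrow> 'w \<Rightarrow> ennreal) \<Rightarrow> bool" where
  "product_sup_measure P \<mu> \<alpha> k X Y \<longleftrightarrow>
     (\<exists>(E :: nat \<Rightarrow> 'e set) Z.
        range E \<subseteq> sets \<mu> \<and> incseq E \<and> (\<Union>n. E n) = space \<mu> \<and>
        (\<forall>n. 0 < emeasure \<mu> (E n) \<and> emeasure \<mu> (E n) < \<infinity>) \<and>
        (\<forall>n. product_sup_measure_finite P (density \<mu> (indicator (E n))) \<alpha> k
               (\<lambda>A. X (A \<inter> E n)) (Z n)) \<and>
        (\<forall>A\<in>sets (off_diagonal k \<mu>). Y A \<in> borel_measurable P \<and>
           (AE w in P. Y A w = (SUP n. Z n A w))))"

text \<open>\<open>simple_function_of N a A\<close> is the function with value \<open>a i\<close> on \<open>A i\<close> for \<open>i < N\<close>, and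
  \<open>simple_extremal_integral\<close> its integral against \<open>Y\<close>.\<close>

definition simple_data :: "nat \<Rightarrow> 'e measure \<Rightarrow> nat \<Rightarrow> (nat \<Rightarrow> real) \<Rightarrow> (nat \<Rightarrow> (nat \<Rightarrow> 'e) set) \<Rightarrow> bool" where
  "simple_data k M N a A \<longleftrightarrow>
     (\<forall>i<N. 0 < a i \<and> A i \<in> sets (off_diagonal k M)) \<and> disjoint_family_on A {..<N}"

definition simple_function_of ::
  "nat \<Rightarrow> (nat \<Rightarrow> real) \<Rightarrow> (nat \<Rightarrow> (nat \<Rightarrow> 'e) set) \<Rightarrow> (nat \<Rightarrow> 'e) \<Rightarrow> ennreal" where
  "simple_function_of N a A u = (\<Sum>i<N. ennreal (a i) * indicator (A i) u)"

definition simple_extremal_integral ::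
  "((nat \<Rightarrow> 'e) set \<Rightarrow> 'w \<Rightarrow> ennreal) \<Rightarrow> nat \<Rightarrow> (nat \<Rightarrow> real) \<Rightarrow> (nat \<Rightarrow> (nat \<Rightarrow> 'e) set) \<Rightarrow>
   'w \<Rightarrow> ennreal" where
  "simple_extremal_integral Y N a A w = (SUP i\<in>{..<N}. ennreal (a i) * Y (A i) w)"

definition multiple_extremal_integral ::
  "'w measure \<Rightarrow> 'e measure \<Rightarrow> nat \<Rightarrow> ((nat \<Rightarrow> 'e) set \<Rightarrow> 'w \<Rightarrow> ennreal) \<Rightarrow>
   ((nat \<Rightarrow> 'e) \<Rightarrow> ennreal) \<Rightarrow> ('w \<Rightarrow> ennreal) \<Rightarrow> bool" where
  "multiple_extremal_integral P \<mu> k Y f I \<longleftrightarrow>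
     I \<in> borel_measurable P \<and>
     (\<exists>(N :: nat \<Rightarrow> nat) a A.
        (\<forall>n. simple_data k \<mu> (N n) (a n) (A n)) \<and>
        (\<forall>n u. simple_function_of (N n) (a n) (A n) u
                 \<le> simple_function_of (N (Suc n)) (a (Suc n)) (A (Suc n)) u) \<and>
        (AE u in power_measure k \<mu>. (\<lambda>n. simple_function_of (N n) (a n) (A n) u) \<longlonglongrightarrow> f u) \<and>
        (AE w in P. (\<lambda>n. simple_extremal_integral Y (N n) (a n) (A n) w) \<longlonglongrightarrow> I w))"

end

theory Submission
  imports Defs
begin

text \<open>The obstacle to finiteness is that a product of two or more independent Frechet variables has a tail
heavier than \<open>x\<^sup>-\<^sup>\<alpha>\<close>: one factor may be huge while another is small. The idea is to work on an event
\<open>good R\<close> on which \<open>X\<close> is at most a multiple of \<open>\<psi>\<^sup>1\<^sup>/\<^sup>\<alpha>\<close> locally. In the LePage representation this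
amounts to \<open>\<Gamma>\<^sub>1 \<ge> 1 / R\<close>, and its complement has probability at most \<open>1 / R\<close>
(\<open>emeasure_not_good\<close>). For bounded factors the product of \<open>k\<close> independent variables with tails
\<open>p i / v\<close> exceeds \<open>s\<close> with probability at most
\<open>(\<Prod>i. p i) / s \<cdot> (1 + ln\<^sub>+ (const / s))\<^sup>k\<^sup>-\<^sup>1\<close>
(\<open>prob_prod_greater_le\<close>), in accordance with the volume of
\<open>{t. (\<forall>i. 1 / R \<le> t i) \<and> (\<Prod>i. t i) \<le> z}\<close>. This is where the logarithm to the power \<open>k - 1\<close>
comes from.

A union bound over disjoint small rectangles (\<open>emeasure_rectangles_le\<close>) shows that on \<open>good R\<close> the
maximum of the products over the rectangles in a finite family exceeds \<open>y\<close> with probability at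
most the integral over their union of an explicit weight. The bound passes to general sets by the
approximation in measure that defines the product sup measure
(\<open>emeasure_product_sup_measure_le\<close>), and by a union bound over the level sets to simple functions.
Expressed with respect to \<open>m\<close>, the weight for a simple function below \<open>f\<close> is at most
\<open>const \<cdot> x\<^sup>-\<^sup>\<alpha>\<close> times the integrand of the \<open>L ln L\<close> functional (\<open>log_tail_le_L_ln_L\<close>). So on
\<open>good R\<close> the integrals of all the simple functions have tails \<open>O(x\<^sup>-\<^sup>\<alpha>)\<close>, uniformly, and their
limit is almost surely finite there; finally \<open>R\<close> tends to infinity.\<close>

section \<open>Products of bounded independent variables\<close>

text \<open>Layer cake: the part of the mean of \<open>U\<close> where \<open>U > a\<close> is at most
\<open>a \<cdot> P(U > a)\<close> plus the integral of the tail over \<open>[a, b]\<close>. For a tail of order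
\<open>c / v\<close> this integral is logarithmic, and each use of the lemma costs one factor \<open>1 + ln (b / a)\<close>.\<close>

lemma (in prob_space) nn_integral_truncated_le:
  fixes U :: "'a \<Rightarrow> real"
  assumes U [measurable]: "U \<in> borel_measurable M"
    and "0 < a" "a \<le> b" "0 \<le> c"
    and bound: "\<And>w. w \<in> space M \<Longrightarrow> U w \<le> b"
    and tail: "\<And>v. a \<le> v \<Longrightarrow> prob {w \<in> space M. v < U w} \<le> c / v"
  shows "(\<integral>\<^sup>+ w. ennreal (U w) * indicator {w \<in> space M. a < U w} w \<partial>M)
           \<le> ennreal (c * (1 + ln (b / a)))"
proof -
  interpret PL: pair_sigma_finite M lborel ..
  let ?S = "\<lambda>v. {w \<in> space M. v < U w}"
  let ?F = "\<lambda>w v. indicator {a..b} v * indicator (?S v) w :: ennreal"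
  have F: "(\<lambda>(w, v). ?F w v) \<in> borel_measurable (M \<Otimes>\<^sub>M lborel)"
  proof -
    have "(\<lambda>(w, v). ?F w v)
      = (\<lambda>p. indicator {a..b} (snd p) * (if fst p \<in> space M \<and> snd p < U (fst p) then 1 else 0))"
      by (auto simp: fun_eq_iff indicator_def)
    also have "\<dots> \<in> borel_measurable (M \<Otimes>\<^sub>M lborel)" by measurable
    finally show ?thesis .
  qed
  have "(\<integral>\<^sup>+ w. ennreal (U w) * indicator (?S a) w \<partial>M)
      \<le> (\<integral>\<^sup>+ w. ennreal a * indicator (?S a) w + (\<integral>\<^sup>+ v. ?F w v \<partial>lborel) \<partial>M)"
  proof (rule nn_integral_mono)
    fix w assume w: "w \<in> space M"
    show "ennreal (U w) * indicator (?S a) w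
        \<le> ennreal a * indicator (?S a) w + (\<integral>\<^sup>+ v. ?F w v \<partial>lborel)"
    proof (cases "a < U w")
      case True
      have "(\<integral>\<^sup>+ v. ?F w v \<partial>lborel) = (\<integral>\<^sup>+ v. indicator {a..<U w} v \<partial>lborel)"
        using w bound[OF w] by (intro nn_integral_cong) (auto simp: indicator_def)
      also have "\<dots> = ennreal (U w - a)" using True by simp
      finally have "ennreal a + (\<integral>\<^sup>+ v. ?F w v \<partial>lborel) = ennreal (U w)"
        using True \<open>0 < a\<close> by (simp flip: ennreal_plus)
      then show ?thesis using True w by simp
    qed simp
  qed
  also have "\<dots> = (\<integral>\<^sup>+ w. ennreal a * indicator (?S a) w \<partial>M)
      + (\<integral>\<^sup>+ w. (\<integral>\<^sup>+ v. ?F w v \<partial>lborel) \<partial>M)"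
    using F by (intro nn_integral_add lborel.borel_measurable_nn_integral) simp_all
  also have "(\<integral>\<^sup>+ w. ennreal a * indicator (?S a) w \<partial>M) = ennreal a * emeasure M (?S a)"
    by (intro nn_integral_cmult_indicator) measurable
  also have "(\<integral>\<^sup>+ w. (\<integral>\<^sup>+ v. ?F w v \<partial>lborel) \<partial>M) = (\<integral>\<^sup>+ v. (\<integral>\<^sup>+ w. ?F w v \<partial>M) \<partial>lborel)"
    using F by (rule PL.Fubini'[symmetric])
  also have "\<dots> = (\<integral>\<^sup>+ v. indicator {a..b} v * emeasure M (?S v) \<partial>lborel)"
    by (intro nn_integral_cong nn_integral_cmult_indicator) measurable
  also have "\<dots> \<le> (\<integral>\<^sup>+ v. ennreal (c / v) * indicator {a..b} v \<partial>lborel)"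
    using tail by (intro nn_integral_mono) (auto simp: indicator_def emeasure_eq_measure intro!: ennreal_leI)
  also have "\<dots> = ennreal (c * ln b - c * ln a)"
    using \<open>0 < a\<close> \<open>a \<le> b\<close> \<open>0 \<le> c\<close>
    by (intro nn_integral_FTC_Icc) (auto intro!: derivative_eq_intros simp: field_simps)
  also have "c * ln b - c * ln a = c * ln (b / a)"
    using \<open>0 < a\<close> \<open>a \<le> b\<close> by (simp add: ln_div algebra_simps)
  also have "ennreal a * emeasure M (?S a) \<le> ennreal c"
    using tail[of a] \<open>0 < a\<close> by (simp add: emeasure_eq_measure field_simps ennreal_leI flip: ennreal_mult)
  finally show ?thesis
    using \<open>0 < a\<close> \<open>a \<le> b\<close> \<open>0 \<le> c\<close> by (simp add: algebra_simps add_mono flip: ennreal_plus)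
qed

text \<open>The source of the power \<open>k - 1\<close> of the logarithm. Conditioning on all factors but the last bounds
the tail of the product by the truncated mean of a product with one factor less. Since the factors
are bounded, the truncation confines the mean to a bounded range of levels, and the
induction picks up one logarithm for each factor after the first.\<close>

lemma (in prob_space) prob_prod_greater_le:
  fixes V :: "nat \<Rightarrow> 'a \<Rightarrow> real"
  assumes "indep_vars (\<lambda>_. borel) V {..n}"
    and "\<And>i w. i \<le> n \<Longrightarrow> w \<in> space M \<Longrightarrow> 0 \<le> V i w"
    and "\<And>i w. i \<le> n \<Longrightarrow> w \<in> space M \<Longrightarrow> V i w \<le> \<kappa> i"
    and "\<And>i. i \<le> n \<Longrightarrow> 0 < \<kappa> i" and "\<And>i. i \<le> n \<Longrightarrow> 0 \<le> p i"
    and "\<And>i v. i \<le> n \<Longrightarrow> 0 < v \<Longrightarrow> prob {w \<in> space M. v < V i w} \<le> p i / v"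
    and "0 < s"
  shows "prob {w \<in> space M. s < (\<Prod>i\<le>n. V i w)}
    \<le> (\<Prod>i\<le>n. p i) / s * (1 + ln (max 1 ((\<Prod>i\<le>n. \<kappa> i) / s))) ^ n"
  using assms
proof (induction n arbitrary: s)
  case 0
  then show ?case by simp
next
  case (Suc n)
  define U where "U w = (\<Prod>i\<le>n. V i w)" for w
  define b where "b = (\<Prod>i\<le>n. \<kappa> i)"
  define q where "q = (\<Prod>i\<le>n. p i)"
  \<comment> \<open>As the last factor is at most \<open>\<kappa> (Suc n)\<close>, the product exceeds \<open>s\<close> only where \<open>U > a\<close>.\<close>
  define a where "a = s / \<kappa> (Suc n)"
  have a: "0 < a" and b: "0 < b" and q: "0 \<le> q"
    using Suc.prems by (auto simp: a_def b_def q_def intro!: prod_pos prod_nonneg)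
  have ba: "(\<Prod>i\<le>Suc n. \<kappa> i) / s = b / a"
    using Suc.prems(4)[of "Suc n"] by (simp add: a_def b_def)
  have indep: "indep_vars (\<lambda>_. borel) V {..n}"
    by (rule indep_vars_subset[OF Suc.prems(1)]) auto
  have tailU: "prob {w \<in> space M. v < U w} \<le> q / v * (1 + ln (max 1 (b / v))) ^ n" if "0 < v" for v
    unfolding U_def q_def b_def using indep Suc.prems that by (intro Suc.IH) auto
  have U0: "0 \<le> U w" and Ub: "U w \<le> b" if "w \<in> space M" for w
    using Suc.prems(2,3) that by (auto simp: U_def b_def intro!: prod_nonneg prod_mono)
  let ?V = "V (Suc n)"
  have "indep_var borel ?V borel U"
    unfolding U_def using Suc.prems(1) by (intro indep_vars_prod) (auto simp: atMost_Suc)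
  then have rv [measurable]: "?V \<in> borel_measurable M" "U \<in> borel_measurable M"
    and indep2: "distr M borel ?V \<Otimes>\<^sub>M distr M borel U
        = distr M (borel \<Otimes>\<^sub>M borel) (\<lambda>w. (?V w, U w))"
    by (auto simp: indep_var_distribution_eq)
  interpret DV: prob_space "distr M borel ?V" by (rule prob_space_distr) measurable
  interpret DU: prob_space "distr M borel U" by (rule prob_space_distr) measurable
  interpret pair_sigma_finite "distr M borel ?V" "distr M borel U" ..
  let ?A = "{z :: real \<times> real. s < fst z * snd z}"
  have A [measurable]: "?A \<in> sets (borel \<Otimes>\<^sub>M borel)"
  proof -
    have "{z \<in> space (borel \<Otimes>\<^sub>M borel). s < fst z * snd z} \<in> sets (borel \<Otimes>\<^sub>M borel)"
      by measurable
    then show ?thesis by (simp add: space_pair_measure)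
  qed
  have "{w \<in> space M. s < (\<Prod>i\<le>Suc n. V i w)} = (\<lambda>w. (?V w, U w)) -` ?A \<inter> space M"
    by (auto simp: U_def mult.commute)
  then have "emeasure M {w \<in> space M. s < (\<Prod>i\<le>Suc n. V i w)}
      = emeasure (distr M borel ?V \<Otimes>\<^sub>M distr M borel U) ?A"
    by (simp add: indep2 emeasure_distr)
  also have "\<dots> = (\<integral>\<^sup>+ u. emeasure (distr M borel ?V) ((\<lambda>v. (v, u)) -` ?A) \<partial>distr M borel U)"
    by (rule emeasure_pair_measure_alt2) simp
  also have "\<dots> = (\<integral>\<^sup>+ w'. emeasure M {w \<in> space M. s < ?V w * U w'} \<partial>M)"
  proof (subst nn_integral_distr)
    show "(\<lambda>u. emeasure (distr M borel ?V) ((\<lambda>v. (v, u)) -` ?A)) \<in> borel_measurable (distr M borel U)"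
      using measurable_emeasure_Pair2[of ?A] by simp
    show "(\<integral>\<^sup>+ w'. emeasure (distr M borel ?V) ((\<lambda>v. (v, U w')) -` ?A) \<partial>M)
        = (\<integral>\<^sup>+ w'. emeasure M {w \<in> space M. s < ?V w * U w'} \<partial>M)"
      by (intro nn_integral_cong, subst emeasure_distr)
         (auto intro!: arg_cong[where f="emeasure M"])
  qed simp
  also have "\<dots> \<le> (\<integral>\<^sup>+ w'. ennreal (p (Suc n) / s)
      * (ennreal (U w') * indicator {w \<in> space M. a < U w} w') \<partial>M)"
  proof (rule nn_integral_mono)
    fix w' assume w': "w' \<in> space M"
    show "emeasure M {w \<in> space M. s < ?V w * U w'}
        \<le> ennreal (p (Suc n) / s) * (ennreal (U w') * indicator {w \<in> space M. a < U w} w')"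
    proof (cases "a < U w'")
      case True
      then have pos: "0 < U w'" using a by simp
      have "{w \<in> space M. s < ?V w * U w'} = {w \<in> space M. s / U w' < ?V w}"
        using pos by (auto simp: field_simps)
      also have "emeasure M \<dots> \<le> ennreal (p (Suc n) / (s / U w'))"
        unfolding emeasure_eq_measure using pos Suc.prems(7)
        by (intro ennreal_leI Suc.prems(6)) auto
      also have "p (Suc n) / (s / U w') = p (Suc n) / s * U w'" by simp
      finally show ?thesis
        using True w' Suc.prems(5)[of "Suc n"] Suc.prems(7) pos by (simp flip: ennreal_mult)
    next
      case False
      have "?V w * U w' \<le> s" if "w \<in> space M" for w
      proof -
        have "?V w * U w' \<le> \<kappa> (Suc n) * a"
          using False U0[OF w'] Suc.prems(3)[of "Suc n" w] Suc.prems(4)[of "Suc n"] that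
          by (intro mult_mono) auto
        then show ?thesis using Suc.prems(4)[of "Suc n"] by (simp add: a_def)
      qed
      then have "{w \<in> space M. s < ?V w * U w'} = {}" by force
      then show ?thesis by (metis emeasure_empty zero_le)
    qed
  qed
  also have "\<dots> = ennreal (p (Suc n) / s)
      * (\<integral>\<^sup>+ w'. ennreal (U w') * indicator {w \<in> space M. a < U w} w' \<partial>M)"
    by (intro nn_integral_cmult) measurable
  also have "\<dots> \<le> ennreal (p (Suc n) / s) * ennreal (q * (1 + ln (max 1 (b / a))) ^ Suc n)"
  proof (intro mult_left_mono)
    show "(\<integral>\<^sup>+ w'. ennreal (U w') * indicator {w \<in> space M. a < U w} w' \<partial>M)
        \<le> ennreal (q * (1 + ln (max 1 (b / a))) ^ Suc n)"
    proof (cases "a \<le> b")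
      case True
      then have m: "max 1 (b / a) = b / a" using a by simp
      have "(\<integral>\<^sup>+ w'. ennreal (U w') * indicator {w \<in> space M. a < U w} w' \<partial>M)
          \<le> ennreal (q * (1 + ln (b / a)) ^ n * (1 + ln (b / a)))"
      proof (rule nn_integral_truncated_le[OF rv(2) a True])
        show "0 \<le> q * (1 + ln (b / a)) ^ n"
          using q a True by (intro mult_nonneg_nonneg zero_le_power) (auto intro!: add_nonneg_nonneg)
        fix v assume v: "a \<le> v"
        have "ln (max 1 (b / v)) \<le> ln (b / a)"
          using v a b True by (subst ln_le_cancel_iff) (auto simp: frac_le divide_left_mono)
        then have "q / v * (1 + ln (max 1 (b / v))) ^ n \<le> q / v * (1 + ln (b / a)) ^ n"
          using q v a by (intro mult_left_mono power_mono) auto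
        then show "prob {w \<in> space M. v < U w} \<le> q * (1 + ln (b / a)) ^ n / v"
          using tailU[of v] v a by (simp add: mult.commute)
      qed (use Ub in auto)
      then show ?thesis unfolding m by (simp add: mult_ac)
    next
      case False
      then have "\<And>w. w \<in> space M \<Longrightarrow> \<not> a < U w" using Ub by force
      then have "(\<integral>\<^sup>+ w'. ennreal (U w') * indicator {w \<in> space M. a < U w} w' \<partial>M) = (\<integral>\<^sup>+ w'. 0 \<partial>M)"
        by (intro nn_integral_cong) auto
      then show ?thesis by simp
    qed
  qed simp
  also have "\<dots> = ennreal ((\<Prod>i\<le>Suc n. p i) / s * (1 + ln (max 1 ((\<Prod>i\<le>Suc n. \<kappa> i) / s))) ^ Suc n)"
    unfolding ba using Suc.prems(5)[of "Suc n"] \<open>0 < s\<close> q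
    by (subst ennreal_mult[symmetric]) (auto simp: q_def intro!: mult_nonneg_nonneg)
  finally show ?case
    unfolding emeasure_eq_measure using Suc.prems(5) \<open>0 < s\<close>
    by (subst (asm) ennreal_le_iff)
       (auto intro!: mult_nonneg_nonneg prod_nonneg divide_nonneg_pos zero_le_power add_nonneg_nonneg
          simp del: power_Suc prod.atMost_Suc)
qed

section \<open>Frechet random sup measures\<close>

locale frechet_random_sup_measure = prob_space P for P :: "'w measure" +
  fixes \<mu> :: "'e measure" and \<alpha> :: real and X :: "'e set \<Rightarrow> 'w \<Rightarrow> ennreal"
  assumes alpha_pos: "0 < \<alpha>" and frechet: "frechet_sup_measure P \<mu> \<alpha> X"
begin

lemma X_measurable [measurable]: "A \<in> sets \<mu> \<Longrightarrow> X A \<in> borel_measurable P"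
  using frechet by (simp add: frechet_sup_measure_def)

text \<open>The exact value is \<open>1 - exp (- \<mu>(A) x\<^sup>-\<^sup>\<alpha>)\<close>. Only this linear bound is additive in \<open>A\<close>, which is
what turns union bounds into integrals.\<close>

lemma prob_X_greater_le:
  assumes A: "A \<in> sets \<mu>" "emeasure \<mu> A < \<infinity>" and "0 < x"
  shows "prob {w \<in> space P. ennreal x < X A w} \<le> measure \<mu> A * x powr (- \<alpha>)"
proof -
  have "prob {w \<in> space P. ennreal x < X A w} = 1 - prob {w \<in> space P. X A w \<le> ennreal x}"
    unfolding not_le[symmetric] using A(1) by (intro prob_neg) measurable
  also have "prob {w \<in> space P. X A w \<le> ennreal x} = exp (- measure \<mu> A * x powr (- \<alpha>))"
    using frechet A \<open>0 < x\<close> by (auto simp: frechet_sup_measure_def)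
  also have "1 - exp (- measure \<mu> A * x powr (- \<alpha>)) \<le> measure \<mu> A * x powr (- \<alpha>)"
    using exp_ge_add_one_self[of "- measure \<mu> A * x powr (- \<alpha>)"] by simp
  finally show ?thesis .
qed

lemma AE_X_UN:
  assumes "countable J" "J \<noteq> {}" "\<And>j. j \<in> J \<Longrightarrow> A j \<in> sets \<mu>"
  shows "AE w in P. X (\<Union>j\<in>J. A j) w = (SUP j\<in>J. X (A j) w)"
proof -
  have r: "range (from_nat_into J) = J"
    using assms by (simp add: range_from_nat_into)
  have "\<forall>n. A (from_nat_into J n) \<in> sets \<mu>"
    using assms from_nat_into[of J] by blast
  then have "AE w in P. X (\<Union>n. A (from_nat_into J n)) w = (SUP n. X (A (from_nat_into J n)) w)"
    using frechet by (simp add: frechet_sup_measure_def)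
  moreover have "(\<Union>n. A (from_nat_into J n)) = (\<Union>j\<in>J. A j)"
    by (subst (2) r[symmetric]) (simp add: image_image)
  moreover have "(SUP n. X (A (from_nat_into J n)) w) = (SUP j\<in>J. X (A j) w)" for w
    by (subst (2) r[symmetric]) (simp add: image_image)
  ultimately show ?thesis by simp
qed

text \<open>Monotonicity is the sup property for the two sets \<open>A\<close> and \<open>B\<close>.\<close>

lemma AE_X_mono:
  assumes "A \<in> sets \<mu>" "B \<in> sets \<mu>" "A \<subseteq> B"
  shows "AE w in P. X A w \<le> X B w"
proof -
  have "AE w in P. X (\<Union>C\<in>{A, B}. C) w = (SUP C\<in>{A, B}. X C w)"
    using assms by (intro AE_X_UN) auto
  moreover have "(\<Union>C\<in>{A, B}. C) = B" using assms by auto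
  ultimately show ?thesis by (auto elim!: eventually_mono simp: sup.absorb_iff2 sup_commute) 
qed

lemma AE_X_null:
  assumes "A \<in> sets \<mu>" "emeasure \<mu> A = 0"
  shows "AE w in P. X A w = 0"
proof -
  have "AE w in P. \<not> ennreal (1 / real (Suc n)) < X A w" for n
  proof -
    have "prob {w \<in> space P. ennreal (1 / real (Suc n)) < X A w} = 0"
      using prob_X_greater_le[of A "1 / real (Suc n)"] assms measure_nonneg[of P]
      by (simp add: measure_def order_antisym)
    then show ?thesis
      using assms(1) by (subst AE_iff_measurable[OF _ refl]) (auto simp: emeasure_eq_measure)
  qed
  then have "AE w in P. \<forall>n. \<not> ennreal (1 / real (Suc n)) < X A w"
    by (simp add: AE_all_countable)
  then show ?thesis
  proof eventually_elim
    case (elim w)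
    show "X A w = 0"
    proof (rule ccontr)
      assume "X A w \<noteq> 0"
      then obtain r where "0 < r" "ennreal r < X A w"
        by (metis dense ennreal_cases ennreal_less_zero_iff not_gr_zero order_less_imp_not_less top.extremum_strict)
      moreover obtain n where "1 / real (Suc n) < r"
        using \<open>0 < r\<close> nat_approx_posE by blast
      ultimately show False using elim[rule_format, of n]
        by (meson ennreal_leI le_less_trans less_imp_le)
    qed
  qed
qed

lemma AE_X_finite:
  assumes A: "A \<in> sets \<mu>" "emeasure \<mu> A < \<infinity>"
  shows "AE w in P. X A w < \<infinity>"
proof -
  have "filterlim (\<lambda>n. real (Suc n)) at_top sequentially"
    by (rule filterlim_compose[OF filterlim_real_sequentially filterlim_Suc])
  then have "(\<lambda>n. real (Suc n) powr (- \<alpha>)) \<longlonglongrightarrow> 0"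
    using alpha_pos by (intro tendsto_neg_powr) auto
  then have "(\<lambda>n. measure \<mu> A * real (Suc n) powr (- \<alpha>)) \<longlonglongrightarrow> 0"
    by (rule tendsto_mult_right_zero)
  moreover have "prob {w \<in> space P. X A w = \<infinity>} \<le> measure \<mu> A * real (Suc n) powr (- \<alpha>)" for n
    using A by (intro order_trans[OF finite_measure_mono prob_X_greater_le]) (auto simp: less_top[symmetric])
  ultimately have "prob {w \<in> space P. X A w = \<infinity>} \<le> 0"
    by (intro LIMSEQ_le_const) auto
  then have "prob {w \<in> space P. X A w = \<infinity>} = 0"
    using measure_nonneg[of P] by (intro order_antisym) auto
  then show ?thesis
    using A(1) by (subst AE_iff_measurable[OF _ refl]) (auto simp: emeasure_eq_measure less_top[symmetric])
qed

text \<open>The sets are disjoint, so the \<open>X (A i)\<close> are independent. Their \<open>\<alpha>\<close>-th powers, set to zero above the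
caps \<open>\<kappa> i\<close>, are bounded and have tails \<open>\<mu>(A i) / v\<close>.\<close>

lemma prob_rectangle_greater_le:
  assumes "0 < k" and A: "\<And>i. i < k \<Longrightarrow> A i \<in> sets \<mu>" "\<And>i. i < k \<Longrightarrow> emeasure \<mu> (A i) < \<infinity>"
    and disj: "disjoint_family_on A {..<k}"
    and \<kappa>: "\<And>i. i < k \<Longrightarrow> 0 < \<kappa> i" and "0 < y"
  shows "prob {w \<in> space P. (\<forall>i<k. X (A i) w \<le> ennreal (\<kappa> i powr (1 / \<alpha>)))
                \<and> ennreal y < (\<Prod>i<k. X (A i) w)}
    \<le> (\<Prod>i<k. measure \<mu> (A i)) * y powr (- \<alpha>)
        * (1 + ln (max 1 ((\<Prod>i<k. \<kappa> i) * y powr (- \<alpha>)))) ^ (k - 1)"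
proof -
  define h where "h i x = (if x \<le> ennreal (\<kappa> i powr (1 / \<alpha>)) then enn2real x powr \<alpha> else 0)" for i x
  define V where "V i w = h i (X (A i) w)" for i w
  obtain n where n: "k = Suc n" using \<open>0 < k\<close> by (cases k) auto
  have atMost: "{..<k} = {..n}" by (simp add: n lessThan_Suc_atMost)
  have [measurable]: "h i \<in> borel_measurable borel" for i
    unfolding h_def by measurable
  have "indep_vars (\<lambda>_. borel) (\<lambda>i. X (A i)) {..<k}"
    using frechet A disj by (simp add: frechet_sup_measure_def)
  then have indep: "indep_vars (\<lambda>_. borel) V {..n}"
    unfolding atMost V_def by (rule indep_vars_compose2) measurable
  have V_le: "V i w \<le> \<kappa> i" if "i < k" for i w
  proof (cases "X (A i) w \<le> ennreal (\<kappa> i powr (1 / \<alpha>))")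
    case True
    then have "enn2real (X (A i) w) \<le> \<kappa> i powr (1 / \<alpha>)"
      by (intro enn2real_leI) auto
    then have "enn2real (X (A i) w) powr \<alpha> \<le> (\<kappa> i powr (1 / \<alpha>)) powr \<alpha>"
      using alpha_pos by (intro powr_mono2) auto
    then show ?thesis
      using True \<kappa>[OF that] alpha_pos by (simp add: V_def h_def powr_powr)
  qed (use \<kappa>[OF that] in \<open>simp add: V_def h_def\<close>)
  have V_tail: "prob {w \<in> space P. v < V i w} \<le> measure \<mu> (A i) / v" if "i < k" "0 < v" for i v
  proof -
    have *: "ennreal (v powr (1 / \<alpha>)) < X (A i) w" if "v < V i w" for w
    proof -
      have le: "X (A i) w \<le> ennreal (\<kappa> i powr (1 / \<alpha>))" and "v < enn2real (X (A i) w) powr \<alpha>"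
        using that \<open>0 < v\<close> by (auto simp: V_def h_def split: if_splits)
      then have "v powr (1 / \<alpha>) < (enn2real (X (A i) w) powr \<alpha>) powr (1 / \<alpha>)"
        using alpha_pos \<open>0 < v\<close> by (intro powr_less_mono2) auto
      then have "v powr (1 / \<alpha>) < enn2real (X (A i) w)"
        using alpha_pos by (simp add: powr_powr)
      moreover have "X (A i) w = ennreal (enn2real (X (A i) w))"
        using le by (metis ennreal_enn2real ennreal_less_top le_less_trans)
      ultimately show ?thesis
        by (metis ennreal_lessI enn2real_nonneg less_le_trans le_less_trans powr_ge_zero)
    qed
    have "prob {w \<in> space P. v < V i w} \<le> prob {w \<in> space P. ennreal (v powr (1 / \<alpha>)) < X (A i) w}"
      using * A(1)[OF that(1)] by (intro finite_measure_mono) auto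
    also have "\<dots> \<le> measure \<mu> (A i) * (v powr (1 / \<alpha>)) powr (- \<alpha>)"
      using A that by (intro prob_X_greater_le) auto
    also have "\<dots> = measure \<mu> (A i) / v"
      using alpha_pos that by (simp add: powr_powr powr_minus_divide)
    finally show ?thesis .
  qed
  have "{w \<in> space P. (\<forall>i<k. X (A i) w \<le> ennreal (\<kappa> i powr (1 / \<alpha>)))
                \<and> ennreal y < (\<Prod>i<k. X (A i) w)}
      \<subseteq> {w \<in> space P. y powr \<alpha> < (\<Prod>i\<le>n. V i w)}"
  proof safe
    fix w assume le: "\<forall>i<k. X (A i) w \<le> ennreal (\<kappa> i powr (1 / \<alpha>))"
      and gr: "ennreal y < (\<Prod>i<k. X (A i) w)"
    have "X (A i) w = ennreal (enn2real (X (A i) w))" if "i < k" for i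
      using le that by (metis ennreal_enn2real ennreal_less_top le_less_trans)
    then have "(\<Prod>i<k. X (A i) w) = (\<Prod>i<k. ennreal (enn2real (X (A i) w)))"
      by (intro prod.cong) auto
    also have "\<dots> = ennreal (\<Prod>i<k. enn2real (X (A i) w))" by (rule prod_ennreal) auto
    finally have "y < (\<Prod>i<k. enn2real (X (A i) w))"
      using gr \<open>0 < y\<close> by (simp add: ennreal_less_iff)
    then have "y powr \<alpha> < (\<Prod>i<k. enn2real (X (A i) w)) powr \<alpha>"
      using alpha_pos \<open>0 < y\<close> by (intro powr_less_mono2) auto
    also have "\<dots> = (\<Prod>i<k. enn2real (X (A i) w) powr \<alpha>)"
      by (intro prod_powr_distrib)
    also have "\<dots> = (\<Prod>i\<le>n. V i w)"
      unfolding atMost[symmetric] using le by (intro prod.cong) (auto simp: V_def h_def)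
    finally show "y powr \<alpha> < (\<Prod>i\<le>n. V i w)" .
  qed
  then have "prob {w \<in> space P. (\<forall>i<k. X (A i) w \<le> ennreal (\<kappa> i powr (1 / \<alpha>)))
                \<and> ennreal y < (\<Prod>i<k. X (A i) w)}
      \<le> prob {w \<in> space P. y powr \<alpha> < (\<Prod>i\<le>n. V i w)}"
  proof (rule finite_measure_mono)
    have "\<And>i. i \<in> {..n} \<Longrightarrow> V i \<in> borel_measurable P"
      using indep by (simp add: indep_vars_def)
    then have "(\<lambda>w. \<Prod>i\<le>n. V i w) \<in> borel_measurable P"
      by (rule borel_measurable_prod)
    then show "{w \<in> space P. y powr \<alpha> < (\<Prod>i\<le>n. V i w)} \<in> events" by measurable
  qed
  also have "\<dots> \<le> (\<Prod>i\<le>n. measure \<mu> (A i)) / y powr \<alpha>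
      * (1 + ln (max 1 ((\<Prod>i\<le>n. \<kappa> i) / y powr \<alpha>))) ^ n"
  proof (rule prob_prod_greater_le[OF indep])
    fix i assume "i \<le> n"
    then have i: "i < k" using n by simp
    show "0 < \<kappa> i" by (rule \<kappa>[OF i])
    show "V i w \<le> \<kappa> i" for w by (rule V_le[OF i])
    show "0 \<le> V i w" for w by (simp add: V_def h_def)
    show "prob {w \<in> space P. v < V i w} \<le> measure \<mu> (A i) / v" if "0 < v" for v
      by (rule V_tail[OF i that])
  qed (use \<open>0 < y\<close> in auto)
  finally show ?thesis
    unfolding atMost by (simp add: n powr_minus_divide)
qed

end

section \<open>Measures, rectangles and the diagonal in product spaces\<close>

text \<open>The factor \<open>c\<close> lets the induction move the factors with chosen index out of the product.\<close>

lemma less_prod_SUPD: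
  fixes f :: "nat \<Rightarrow> 'v \<Rightarrow> ennreal"
  assumes "y < c * (\<Prod>i<k. SUP v\<in>W i. f i v)"
  shows "\<exists>s\<in>Pi\<^sub>E {..<k} W. y < c * (\<Prod>i<k. f i (s i))"
  using assms
proof (induction k arbitrary: c)
  case 0
  then show ?case by (auto simp: PiE_def)
next
  case (Suc k)
  let ?p = "\<Prod>i<k. SUP v\<in>W i. f i v"
  have "y < (SUP v\<in>W k. c * ?p * f k v)"
    using Suc.prems by (simp add: SUP_mult_left_ennreal mult.assoc)
  then obtain v where v: "v \<in> W k" "y < (c * f k v) * ?p"
    by (auto simp: less_SUP_iff mult_ac)
  from Suc.IH[OF v(2)] obtain s where s: "s \<in> Pi\<^sub>E {..<k} W" "y < (c * f k v) * (\<Prod>i<k. f i (s i))"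
    by auto
  have "(\<Prod>i<k. f i ((s(k := v)) i)) = (\<Prod>i<k. f i (s i))"
    by (intro prod.cong) auto
  then have "y < c * (\<Prod>i<Suc k. f i ((s(k := v)) i))"
    using s(2) by (simp add: mult_ac)
  moreover have "s(k := v) \<in> Pi\<^sub>E {..<Suc k} W"
    using s(1) v(1) by (auto simp: lessThan_Suc intro!: PiE_fun_upd)
  ultimately show ?case by blast
qed

lemma emeasure_UN_countable_le:
  assumes "countable I" and [measurable]: "\<And>i. i \<in> I \<Longrightarrow> A i \<in> sets M"
  shows "emeasure M (\<Union>i\<in>I. A i) \<le> (\<integral>\<^sup>+ i. emeasure M (A i) \<partial>count_space I)"
proof -
  have [measurable]: "(\<Union>i\<in>I. A i) \<in> sets M"
    using assms by (intro sets.countable_UN') auto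
  have "emeasure M (\<Union>i\<in>I. A i) = (\<integral>\<^sup>+ x. indicator (\<Union>i\<in>I. A i) x \<partial>M)" by simp
  also have "\<dots> \<le> (\<integral>\<^sup>+ x. \<integral>\<^sup>+ i. indicator (A i) x \<partial>count_space I \<partial>M)"
  proof (rule nn_integral_mono)
    fix x
    show "indicator (\<Union>i\<in>I. A i) x \<le> (\<integral>\<^sup>+ i. indicator (A i) x \<partial>count_space I :: ennreal)"
    proof (cases "\<exists>i\<in>I. x \<in> A i")
      case True
      then obtain i where "i \<in> I" "x \<in> A i" by auto
      then have "1 \<le> (\<integral>\<^sup>+ i. indicator (A i) x \<partial>count_space I)"
        using nn_integral_ge_point[of i I "\<lambda>i. indicator (A i) x"] by simp
      moreover have "indicator (\<Union>i\<in>I. A i) x = (1 :: ennreal)"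
        using \<open>i \<in> I\<close> \<open>x \<in> A i\<close> by (intro indicator_simps(1)) blast
      ultimately show ?thesis by simp
    qed auto
  qed
  also have "\<dots> = (\<integral>\<^sup>+ i. emeasure M (A i) \<partial>count_space I)"
    using assms by (subst nn_integral_count_space_nn_integral) (auto intro!: nn_integral_cong)
  finally show ?thesis .
qed

lemma emeasure_UN_incseq_le:
  assumes "incseq A" "\<And>n. A n \<in> sets M" "\<And>n :: nat. emeasure M (A n) \<le> c"
  shows "emeasure M (\<Union>n. A n) \<le> c"
proof -
  have "emeasure M (\<Union>n. A n) = (SUP n. emeasure M (A n))"
    using assms(1,2) by (intro SUP_emeasure_incseq[symmetric]) auto
  also have "\<dots> \<le> c" using assms(3) by (intro SUP_least)
  finally show ?thesis .
qed

lemma sum_disjoint_indicator: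
  fixes b :: "nat \<Rightarrow> ennreal"
  assumes "disjoint_family_on A {..<N}" "i < N" "u \<in> A i"
  shows "(\<Sum>j<N. b j * indicator (A j) u) = b i"
proof -
  have "(\<Sum>j<N. b j * indicator (A j) u) = (\<Sum>j<N. if j = i then b j else 0)"
    using assms by (intro sum.cong) (auto simp: disjoint_family_on_def indicator_def)
  also have "\<dots> = b i" using assms(2) by simp
  finally show ?thesis .
qed

lemma prod_indicator_eq_indicator_PiE:
  fixes k :: nat
  assumes "u \<in> extensional {..<k}"
  shows "(\<Prod>i<k. indicator (A i) (u i) :: ennreal) = indicator (Pi\<^sub>E {..<k} A) u"
proof (cases "u \<in> Pi\<^sub>E {..<k} A")
  case True
  then show ?thesis by (auto simp: PiE_def Pi_def)
next
  case False
  then obtain i where "i < k" "u i \<notin> A i" using assms by (auto simp: PiE_def)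
  then have "(\<Prod>i<k. indicator (A i) (u i) :: ennreal) = 0"
    by (intro prod_zero bexI[of _ i]) simp_all
  then show ?thesis using False by simp
qed

text \<open>Used twice: for the passage from \<open>\<mu>\<close> to \<open>m\<close>, and, with an indicator as density, for the passage
from \<open>\<mu>\<close> to its restriction to a set of finite measure.\<close>

lemma power_measure_density:
  fixes h :: "'e \<Rightarrow> ennreal"
  assumes "sigma_finite_measure M" "sigma_finite_measure (density M h)"
    and h [measurable]: "h \<in> borel_measurable M"
  shows "power_measure k (density M h) = density (power_measure k M) (\<lambda>u. \<Prod>i<k. h (u i))"
proof -
  interpret N: product_sigma_finite "\<lambda>_::nat. M" using assms by (simp add: product_sigma_finite_def)
  interpret D: product_sigma_finite "\<lambda>_::nat. density M h" using assms by (simp add: product_sigma_finite_def)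
  have [measurable]: "(\<lambda>u. \<Prod>i<k. h (u i)) \<in> borel_measurable (power_measure k M)"
    by measurable
  show ?thesis
  proof (rule D.PiM_eqI[symmetric])
    show "sets (density (power_measure k M) (\<lambda>u. \<Prod>i<k. h (u i))) = sets (power_measure k (density M h))"
      by (simp cong: sets_PiM_cong)
    fix A assume "\<And>i. i \<in> {..<k} \<Longrightarrow> A i \<in> sets (density M h)"
    then have A [measurable]: "\<And>i. i < k \<Longrightarrow> A i \<in> sets M" by simp
    have [measurable]: "Pi\<^sub>E {..<k} A \<in> sets (power_measure k M)" by (intro sets_PiM_I_finite) auto
    have "emeasure (density (power_measure k M) (\<lambda>u. \<Prod>i<k. h (u i))) (Pi\<^sub>E {..<k} A)
        = (\<integral>\<^sup>+ u. (\<Prod>i<k. h (u i)) * indicator (Pi\<^sub>E {..<k} A) u \<partial>power_measure k M)"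
      by (rule emeasure_density) measurable
    also have "\<dots> = (\<integral>\<^sup>+ u. (\<Prod>i<k. h (u i) * indicator (A i) (u i)) \<partial>power_measure k M)"
    proof (rule nn_integral_cong)
      fix u assume u: "u \<in> space (power_measure k M)"
      have "u \<in> extensional {..<k}" using u by (simp add: space_PiM PiE_def)
      then show "(\<Prod>i<k. h (u i)) * indicator (Pi\<^sub>E {..<k} A) u = (\<Prod>i<k. h (u i) * indicator (A i) (u i))"
        by (simp add: prod.distrib prod_indicator_eq_indicator_PiE)
    qed
    also have "\<dots> = (\<Prod>i<k. \<integral>\<^sup>+ x. h x * indicator (A i) x \<partial>M)"
      using N.product_nn_integral_prod[of "{..<k}" "\<lambda>i x. h x * indicator (A i) x"] A by auto
    also have "\<dots> = (\<Prod>i<k. emeasure (density M h) (A i))"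
      using A by (intro prod.cong) (auto simp: emeasure_density)
    finally show "emeasure (density (power_measure k M) (\<lambda>u. \<Prod>i<k. h (u i))) (Pi\<^sub>E {..<k} A)
        = (\<Prod>i<k. emeasure (density M h) (A i))" .
  qed simp
qed

lemma emeasure_power_measure_restrict:
  assumes "sigma_finite_measure \<mu>" and E: "E \<in> sets \<mu>" "emeasure \<mu> E < \<infinity>"
    and S: "S \<in> sets (power_measure k \<mu>)"
  shows "emeasure (power_measure k (density \<mu> (indicator E))) S
      = emeasure (power_measure k \<mu>) (S \<inter> Pi\<^sub>E {..<k} (\<lambda>_. E))"
proof -
  have "emeasure (density \<mu> (indicator E)) (space \<mu>) < \<infinity>"
    using E by (simp add: emeasure_density)
  then interpret finite_measure "density \<mu> (indicator E)"
    by (intro finite_measureI) (simp add: space_density less_top[symmetric])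
  have "sigma_finite_measure (density \<mu> (indicator E))" ..
  then have "emeasure (power_measure k (density \<mu> (indicator E))) S
      = emeasure (density (power_measure k \<mu>) (\<lambda>u. \<Prod>i<k. indicator E (u i))) S"
    using assms by (subst power_measure_density) auto
  also have "\<dots> = (\<integral>\<^sup>+ u. (\<Prod>i<k. indicator E (u i)) * indicator S u \<partial>power_measure k \<mu>)"
  proof (rule emeasure_density[OF _ S])
    show "(\<lambda>u. \<Prod>i<k. indicator E (u i) :: ennreal) \<in> borel_measurable (power_measure k \<mu>)"
      using E(1) by measurable
  qed
  also have "\<dots> = (\<integral>\<^sup>+ u. indicator (S \<inter> Pi\<^sub>E {..<k} (\<lambda>_. E)) u \<partial>power_measure k \<mu>)"
  proof (rule nn_integral_cong)
    fix u assume "u \<in> space (power_measure k \<mu>)"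
    then have "u \<in> extensional {..<k}" by (simp add: space_PiM PiE_def)
    then show "(\<Prod>i<k. indicator E (u i)) * indicator S u
        = (indicator (S \<inter> Pi\<^sub>E {..<k} (\<lambda>_. E)) u :: ennreal)"
      by (simp add: prod_indicator_eq_indicator_PiE indicator_inter_arith mult.commute)
  qed
  also have "\<dots> = emeasure (power_measure k \<mu>) (S \<inter> Pi\<^sub>E {..<k} (\<lambda>_. E))"
    using S E(1) by (intro nn_integral_indicator sets.Int sets_PiM_I_finite) auto
  finally show ?thesis .
qed

text \<open>The diagonal is measurable because the space embeds measurably into the real line, where equality
is a measurable relation. Hence sets of the off-diagonal space have a product measure.\<close>

lemma sets_diagonal:
  assumes "borel_isomorphic_to_unit_subset \<mu>"
  shows "diagonal k \<mu> \<in> sets (power_measure k \<mu>)"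
proof -
  obtain B and \<phi> :: "'a \<Rightarrow> real" where B: "bij_betw \<phi> (space \<mu>) B" "\<phi> \<in> \<mu> \<rightarrow>\<^sub>M restrict_space borel B"
    using assms by (auto simp: borel_isomorphic_to_unit_subset_def)
  have [measurable]: "\<phi> \<in> borel_measurable \<mu>"
    using B(2) by (rule measurable_restrict_space2_iff[THEN iffD1, THEN conjunct1])
  have "diagonal k \<mu> = {u \<in> space (power_measure k \<mu>).
      \<exists>i\<in>{..<k}. \<exists>j\<in>{..<k}. i \<noteq> j \<and> \<phi> (u i) = \<phi> (u j)}"
  proof -
    have "\<phi> (u i) = \<phi> (u j) \<longleftrightarrow> u i = u j"
      if "u \<in> space (power_measure k \<mu>)" "i < k" "j < k" for u i j
    proof -
      have "u i \<in> space \<mu>" "u j \<in> space \<mu>" using that by (auto simp: space_PiM)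
      with B(1) show ?thesis by (intro inj_on_eq_iff[of \<phi> "space \<mu>"]) (auto simp: bij_betw_def)
    qed
    then show ?thesis unfolding diagonal_def Bex_def lessThan_iff by (intro Collect_cong) meson
  qed
  also have "\<dots> \<in> sets (power_measure k \<mu>)"
  proof (intro sets.sets_Collect_finite_Ex sets.sets_Collect_conj sets.sets_Collect_const finite_lessThan)
    fix i j assume [measurable]: "i \<in> {..<k}" "j \<in> {..<k}"
    show "{u \<in> space (power_measure k \<mu>). \<phi> (u i) = \<phi> (u j)} \<in> sets (power_measure k \<mu>)"
      by measurable
  qed
  finally show ?thesis .
qed

lemma sets_power_measure_if_off_diagonal:
  assumes "borel_isomorphic_to_unit_subset \<mu>" "A \<in> sets (off_diagonal k \<mu>)"
  shows "A \<in> sets (power_measure k \<mu>)"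
  using assms sets_diagonal[OF assms(1), of k]
  by (auto simp: off_diagonal_def sets_restrict_space)

lemma sets_off_diagonal_cong:
  assumes "sets M = sets N"
  shows "sets (off_diagonal k M) = sets (off_diagonal k N)"
proof -
  have s: "sets (power_measure k M) = sets (power_measure k N)"
    using assms by (intro sets_PiM_cong) auto
  then have "space (power_measure k M) = space (power_measure k N)" by (rule sets_eq_imp_space_eq)
  with s show ?thesis by (simp add: off_diagonal_def diagonal_def sets_restrict_space)
qed

lemma rectangle_in_off_diagonal:
  assumes "\<And>i. i < k \<Longrightarrow> A i \<in> sets M" "disjoint_family_on A {..<k}"
  shows "Pi\<^sub>E {..<k} A \<in> sets (off_diagonal k M)"
proof -
  have s: "Pi\<^sub>E {..<k} A \<in> sets (power_measure k M)"
    using assms(1) by (intro sets_PiM_I_finite) auto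
  have "Pi\<^sub>E {..<k} A \<inter> diagonal k M = {}"
  proof safe
    fix u assume u: "u \<in> Pi\<^sub>E {..<k} A" "u \<in> diagonal k M"
    then obtain i j where "i < k" "j < k" "i \<noteq> j" "u i = u j" by (auto simp: diagonal_def)
    then have "u i \<in> A i \<inter> A j" using u(1) by (auto simp: PiE_def Pi_def)
    then show "u \<in> {}" using assms(2) \<open>i < k\<close> \<open>j < k\<close> \<open>i \<noteq> j\<close> by (auto simp: disjoint_family_on_def)
  qed
  then have "Pi\<^sub>E {..<k} A = (space (power_measure k M) - diagonal k M) \<inter> Pi\<^sub>E {..<k} A"
    using sets.sets_into_space[OF s] by auto
  with s show ?thesis by (auto simp: off_diagonal_def sets_restrict_space)
qed

lemma finite_rectangle_unionD:
  assumes "finite_rectangle_union k M C"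
  shows "\<exists>n (A :: nat \<Rightarrow> nat \<Rightarrow> 'e set).
    (\<forall>i<n. (\<forall>l<k. A i l \<in> sets M) \<and> disjoint_family_on (A i) {..<k})
      \<and> C = (\<Union>i<n. Pi\<^sub>E {..<k} (A i))"
proof -
  obtain n and B :: "nat \<Rightarrow> (nat \<Rightarrow> 'e) set" where B: "\<forall>i<n. off_diagonal_rectangle k M (B i)" "C = (\<Union>i<n. B i)"
    using assms by (auto simp: finite_rectangle_union_def)
  then have "\<forall>i. \<exists>A. i < n \<longrightarrow> (\<forall>l<k. A l \<in> sets M) \<and> disjoint_family_on A {..<k} \<and> B i = Pi\<^sub>E {..<k} A"
    unfolding off_diagonal_rectangle_def by blast
  then obtain A where A: "\<And>i. i < n \<Longrightarrow>
      (\<forall>l<k. A i l \<in> sets M) \<and> disjoint_family_on (A i) {..<k} \<and> B i = Pi\<^sub>E {..<k} (A i)"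
    by metis
  have "C = (\<Union>i<n. Pi\<^sub>E {..<k} (A i))" unfolding B(2) using A by (intro SUP_cong) auto
  with A show ?thesis by blast
qed

lemma finite_rectangle_union_in_off_diagonal:
  assumes "finite_rectangle_union k M C"
  shows "C \<in> sets (off_diagonal k M)"
proof -
  obtain n and A :: "nat \<Rightarrow> nat \<Rightarrow> 'a set"
    where A: "\<forall>i<n. (\<forall>l<k. A i l \<in> sets M) \<and> disjoint_family_on (A i) {..<k}"
      and C: "C = (\<Union>i<n. Pi\<^sub>E {..<k} (A i))"
    using finite_rectangle_unionD[OF assms] by (elim exE conjE)
  show ?thesis
    unfolding C by (intro sets.finite_UN rectangle_in_off_diagonal) (use A in auto)
qed

section \<open>The union bound over rectangles\<close>

text \<open>The bound of \<open>prob_prod_greater_le\<close> for the product of \<open>k\<close> Frechet variables exceeding \<open>y\<close>, per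
unit of the product control measure, when the product of the caps on their \<open>\<alpha>\<close>-th powers is \<open>t\<close>.\<close>

definition log_tail :: "real \<Rightarrow> nat \<Rightarrow> real \<Rightarrow> real \<Rightarrow> real" where
  "log_tail \<alpha> k y t = y powr (- \<alpha>) * (1 + ln (max 1 (t * y powr (- \<alpha>)))) ^ (k - 1)"

lemma log_tail_nonneg: "0 \<le> log_tail \<alpha> k y t"
  by (auto simp: log_tail_def intro!: mult_nonneg_nonneg zero_le_power add_nonneg_nonneg)

lemma log_tail_mono:
  assumes "t \<le> t'" shows "log_tail \<alpha> k y t \<le> log_tail \<alpha> k y t'"
proof -
  have "ln (max 1 (t * y powr (- \<alpha>))) \<le> ln (max 1 (t' * y powr (- \<alpha>)))"
  proof (rule ln_mono)
    show "max 1 (t * y powr (- \<alpha>)) \<le> max 1 (t' * y powr (- \<alpha>))"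
      using mult_right_mono[OF assms, of "y powr (- \<alpha>)"] by (intro max.mono) simp_all
  qed simp
  then show ?thesis
    unfolding log_tail_def by (intro mult_left_mono power_mono) (auto intro!: add_nonneg_nonneg)
qed

lemma borel_measurable_log_tail [measurable]: "log_tail \<alpha> k y \<in> borel_measurable borel"
  unfolding log_tail_def[abs_def] by measurable

text \<open>The density is real and positive everywhere. A density that is so only almost everywhere can be
changed on a null set.\<close>

locale frechet_density = frechet_random_sup_measure P \<mu> \<alpha> X
  for P :: "'w measure" and \<mu> :: "'e measure" and \<alpha> :: real and X :: "'e set \<Rightarrow> 'w \<Rightarrow> ennreal" +
  fixes m :: "'e measure" and g :: "'e \<Rightarrow> real"
  assumes prob_m: "prob_space m"
    and sigma_finite_mu: "sigma_finite_measure \<mu>"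
    and g_measurable_m: "g \<in> borel_measurable m"
    and g_pos: "0 < g x"
    and density_g: "density m (\<lambda>x. ennreal (g x)) = \<mu>"
begin

lemma sets_m: "sets m = sets \<mu>"
  using density_g by (metis sets_density)

lemma g_measurable [measurable]: "g \<in> borel_measurable \<mu>"
  using g_measurable_m sets_m measurable_cong_sets by blast

text \<open>On a band the density is constant up to the factor \<open>exp 1\<close>.\<close>

definition band :: "int \<Rightarrow> 'e set" where
  "band l = {x \<in> space \<mu>. \<lfloor>ln (g x)\<rfloor> = l}"

lemma sets_band [measurable]: "band l \<in> sets \<mu>"
  unfolding band_def by measurable

lemma g_band:
  assumes "x \<in> band l"
  shows "exp (of_int l) \<le> g x" "g x \<le> exp (of_int l + 1)"
proof -
  have "of_int l \<le> ln (g x)" "ln (g x) \<le> of_int l + 1"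
    using assms by (auto simp: band_def)
  then have "exp (of_int l) \<le> exp (ln (g x))" "exp (ln (g x)) \<le> exp (of_int l + 1)"
    by simp_all
  then show "exp (of_int l) \<le> g x" "g x \<le> exp (of_int l + 1)"
    using g_pos[of x] by simp_all
qed

text \<open>In the LePage representation this event says, up to constants, that \<open>\<Gamma>\<^sub>1 \<ge> 1 / R\<close>: all the points
\<open>\<Gamma>\<^sub>j\<close> that represent a random sup measure with control measure \<open>m\<close> are at least \<open>1 / R\<close>. Read on
the bands, it caps \<open>X\<close> by a multiple of the density to the power \<open>1 / \<alpha>\<close>.\<close>

definition good :: "real \<Rightarrow> 'w set" where
  "good R = {w \<in> space P. \<forall>l. X (band l) w \<le> ennreal ((R * exp (of_int l + 1)) powr (1 / \<alpha>))}"

lemma sets_good [measurable]: "good R \<in> sets P"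
  unfolding good_def by measurable

text \<open>The \<open>l\<close>-th cap is exceeded with probability at most \<open>\<mu>(band l) / (R exp (l + 1)) \<le> m(band l) / R\<close>,
and \<open>m\<close> has mass one.\<close>

lemma emeasure_not_good:
  assumes "0 < R"
  shows "emeasure P (space P - good R) \<le> ennreal (1 / R)"
proof -
  interpret m: prob_space m by (rule prob_m)
  have [measurable_cong]: "sets m = sets \<mu>" by (rule sets_m)
  let ?c = "\<lambda>l. (R * exp (of_int l + 1)) powr (1 / \<alpha>)"
  let ?B = "\<lambda>l. {w \<in> space P. ennreal (?c l) < X (band l) w}"
  have le: "emeasure P (?B l) \<le> ennreal (1 / R) * emeasure m (band l)" for l :: int
  proof -
    have [measurable]: "band l \<in> sets m" using sets_band sets_m by simp
    have "emeasure (density m (\<lambda>x. ennreal (g x))) (band l)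
        = (\<integral>\<^sup>+ x. ennreal (g x) * indicator (band l) x \<partial>m)"
      using g_measurable_m by (intro emeasure_density) measurable
    also have "\<dots> \<le> (\<integral>\<^sup>+ x. ennreal (exp (of_int l + 1)) * indicator (band l) x \<partial>m)"
      using g_band(2)[of _ l] by (intro nn_integral_mono) (auto simp: indicator_def ennreal_leI)
    also have "\<dots> = ennreal (exp (of_int l + 1) * measure m (band l))"
      by (simp add: nn_integral_cmult_indicator m.emeasure_eq_measure ennreal_mult)
    finally have mu: "emeasure \<mu> (band l) \<le> ennreal (exp (of_int l + 1) * measure m (band l))"
      unfolding density_g .
    then have fin: "emeasure \<mu> (band l) < \<infinity>" by (simp add: order_le_less_trans)
    have "measure \<mu> (band l) \<le> exp (of_int l + 1) * measure m (band l)"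
      using mu unfolding measure_def[of \<mu>] by (intro enn2real_leI) auto
    moreover have "prob (?B l) \<le> measure \<mu> (band l) * ?c l powr (- \<alpha>)"
      using assms fin by (intro prob_X_greater_le) auto
    moreover have "?c l powr (- \<alpha>) = 1 / (R * exp (of_int l + 1))"
      using assms alpha_pos by (simp add: powr_powr powr_minus_divide)
    ultimately have "prob (?B l) \<le> exp (of_int l + 1) * measure m (band l) * (1 / (R * exp (of_int l + 1)))"
      using assms by (smt (verit) divide_nonneg_nonneg exp_ge_zero mult_nonneg_nonneg mult_right_mono)
    then have "prob (?B l) \<le> 1 / R * measure m (band l)" by simp
    then show ?thesis
      using assms unfolding emeasure_eq_measure m.emeasure_eq_measure
      by (subst ennreal_mult[symmetric]) (auto intro: ennreal_leI)
  qed
  have "space P - good R = (\<Union>l. ?B l)" by (auto simp: good_def not_le) (meson leD)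
  then have "emeasure P (space P - good R) \<le> (\<integral>\<^sup>+ l. emeasure P (?B l) \<partial>count_space UNIV)"
    using emeasure_UN_countable_le[of UNIV ?B P] by simp
  also have "\<dots> \<le> (\<integral>\<^sup>+ l. ennreal (1 / R) * emeasure m (band l) \<partial>count_space UNIV)"
    by (intro nn_integral_mono le)
  also have "\<dots> = ennreal (1 / R) * (\<integral>\<^sup>+ l. emeasure m (band l) \<partial>count_space UNIV)"
    by (rule nn_integral_cmult) simp
  also have "(\<integral>\<^sup>+ l. emeasure m (band l) \<partial>count_space UNIV) = emeasure m (\<Union>l. band l)"
    using sets_band sets_m
    by (intro emeasure_UN_countable[symmetric]) (auto simp: disjoint_family_on_def band_def)
  also have "\<dots> \<le> 1" by (rule m.emeasure_le_1)
  finally show ?thesis by (simp add: mult_left_mono)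
qed

text \<open>The caps on the bands alone give a density with respect to \<open>\<mu>\<close> that may be unbounded if \<open>g\<close> is. A
further cap \<open>K\<close> on a set of finite measure bounds it, which makes it continuous under approximation
of sets in measure.\<close>

definition capped_weight :: "nat \<Rightarrow> real \<Rightarrow> real \<Rightarrow> real \<Rightarrow> (nat \<Rightarrow> 'e) \<Rightarrow> real" where
  "capped_weight k y R K u = log_tail \<alpha> k y (min ((R * exp 1) ^ k * (\<Prod>i<k. g (u i))) (K ^ k))"

lemma borel_measurable_capped_weight [measurable]:
  "capped_weight k y R K \<in> borel_measurable (power_measure k \<mu>)"
  unfolding capped_weight_def[abs_def] by measurable

text \<open>The sets \<open>A j i\<close> generate a finite algebra; its atoms, cut along the bands,
form a countable partition, and every rectangle is a disjoint union of rectangles with sides in this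
partition. On such a rectangle all the caps are constant and \<open>prob_rectangle_greater_le\<close> applies.
Counting each small rectangle once makes the bounds add up to an integral over the union, although
the given rectangles may overlap.\<close>

lemma emeasure_rectangles_le:
  fixes A :: "'j \<Rightarrow> nat \<Rightarrow> 'e set"
  assumes J: "finite J" and "0 < k"
    and A: "\<And>j i. j \<in> J \<Longrightarrow> i < k \<Longrightarrow> A j i \<in> sets \<mu>"
    and AF: "\<And>j i. j \<in> J \<Longrightarrow> i < k \<Longrightarrow> A j i \<subseteq> F"
    and disj: "\<And>j. j \<in> J \<Longrightarrow> disjoint_family_on (A j) {..<k}"
    and F: "F \<in> sets \<mu>" "emeasure \<mu> F < \<infinity>"
    and pos: "0 < R" "0 < K" "0 < y"
  shows "emeasure P {w \<in> space P. w \<in> good R \<and> X F w \<le> ennreal (K powr (1 / \<alpha>))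
            \<and> (\<exists>j\<in>J. ennreal y < (\<Prod>i<k. X (A j i) w))}
      \<le> emeasure (density (power_measure k \<mu>) (\<lambda>u. ennreal (capped_weight k y R K u)))
            (\<Union>j\<in>J. Pi\<^sub>E {..<k} (A j))"
    (is "emeasure P ?event \<le> emeasure ?D _")
proof -
  interpret product_sigma_finite "\<lambda>_::nat. \<mu>"
    using sigma_finite_mu by (simp add: product_sigma_finite_def)
  \<comment> \<open>The code of a point says which sets contain it and in which band it lies. The sets \<open>Q v\<close> of
    points with code \<open>v\<close> are the sides of the small rectangles, which are indexed by \<open>S\<close>.\<close>
  define code where "code x = ({(j, i). j \<in> J \<and> i < k \<and> x \<in> A j i}, \<lfloor>ln (g x)\<rfloor>)" for x
  define Q where "Q v = {x \<in> space \<mu>. code x = v}" for v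
  define V where "V = Pow (J \<times> {..<k}) \<times> (UNIV :: int set)"
  define W where "W j i = {v \<in> V. (j, i) \<in> fst v}" for j i
  define \<kappa> where "\<kappa> v = min (R * exp (of_int (snd v) + 1)) K" for v :: "('j \<times> nat) set \<times> int"
  define S where "S = {s \<in> Pi\<^sub>E {..<k} (\<lambda>_. V). inj_on s {..<k} \<and> (\<exists>j\<in>J. \<forall>i<k. (j, i) \<in> fst (s i))}"
  define E where "E s = {w \<in> space P. (\<forall>i<k. X (Q (s i)) w \<le> ennreal (\<kappa> (s i) powr (1 / \<alpha>)))
      \<and> ennreal y < (\<Prod>i<k. X (Q (s i)) w)}" for s
  have V: "countable V"
    unfolding V_def using J by (intro countable_SIGMA countable_finite[of "Pow _"] countableI_type) auto
  have S: "countable S"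
    by (rule countable_subset[of _ "Pi\<^sub>E {..<k} (\<lambda>_. V)"]) (auto simp: S_def intro!: countable_PiE V)
  have Q [measurable]: "Q v \<in> sets \<mu>" for v
  proof -
    let ?C = "{x \<in> space \<mu>. \<forall>p\<in>J \<times> {..<k}. (x \<in> A (fst p) (snd p)) = (p \<in> fst v)}"
    have C: "?C \<in> sets \<mu>"
    proof (rule sets.sets_Collect_finite_All)
      fix p assume p: "p \<in> J \<times> {..<k}"
      then have "A (fst p) (snd p) \<in> sets \<mu>" using A by auto
      then show "{x \<in> space \<mu>. (x \<in> A (fst p) (snd p)) = (p \<in> fst v)} \<in> sets \<mu>"
        by measurable
    qed (use J \<open>0 < k\<close> in auto)
    show ?thesis
    proof (cases "fst v \<subseteq> J \<times> {..<k}")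
      case True
      then have "Q v = ?C \<inter> band (snd v)"
        unfolding Q_def code_def band_def by (cases v) auto
      with C show ?thesis by auto
    next
      case False
      then have "Q v = {}" unfolding Q_def code_def by (cases v) auto
      then show ?thesis by simp
    qed
  qed
  have AQ: "A j i = (\<Union>v\<in>W j i. Q v)" if "j \<in> J" "i < k" for j i
  proof -
    have "x \<in> (\<Union>v\<in>W j i. Q v)" if "x \<in> A j i" for x
    proof -
      have "x \<in> Q (code x)"
        using that sets.sets_into_space[OF A[OF \<open>j \<in> J\<close> \<open>i < k\<close>]] by (auto simp: Q_def)
      moreover have "code x \<in> W j i"
        using that \<open>j \<in> J\<close> \<open>i < k\<close> by (auto simp: W_def V_def code_def)
      ultimately show ?thesis by blast
    qed
    moreover have "x \<in> A j i" if "x \<in> Q v" "v \<in> W j i" for x v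
      using that by (auto simp: Q_def W_def code_def)
    ultimately show ?thesis by blast
  qed
  have QA: "Q v \<subseteq> A j i" if "(j, i) \<in> fst v" for v j i
    using that by (auto simp: Q_def code_def)
  have QB: "Q v \<subseteq> band (snd v)" for v
    by (auto simp: Q_def code_def band_def)
  have QF: "Q v \<subseteq> F" if "v \<in> V" "fst v \<noteq> {}" for v
  proof -
    from that(2) obtain j i where ji: "(j, i) \<in> fst v" by auto
    then have "j \<in> J" "i < k" using that(1) by (auto simp: V_def)
    with ji show ?thesis using QA AF by blast
  qed
  have E [measurable]: "E s \<in> sets P" for s
    unfolding E_def by measurable

  have "AE w in P. \<forall>j\<in>J. \<forall>i\<in>{..<k}. X (A j i) w = (SUP v\<in>W j i. X (Q v) w)"
  proof (intro AE_finite_allI J finite_lessThan)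
    fix j i assume ji: "j \<in> J" "i \<in> {..<k}"
    then have "({(j, i)}, 0) \<in> W j i" by (auto simp: W_def V_def)
    moreover have "countable (W j i)"
      by (rule countable_subset[OF _ V]) (auto simp: W_def)
    ultimately have "AE w in P. X (\<Union>v\<in>W j i. Q v) w = (SUP v\<in>W j i. X (Q v) w)"
      using Q by (intro AE_X_UN) blast+
    moreover have "A j i = (\<Union>v\<in>W j i. Q v)" using ji by (intro AQ) auto
    ultimately show "AE w in P. X (A j i) w = (SUP v\<in>W j i. X (Q v) w)" by simp
  qed
  moreover have "AE w in P. \<forall>v\<in>V. X (Q v) w \<le> X (band (snd v)) w"
    unfolding AE_ball_countable[OF V]
    by (intro ballI AE_X_mono Q sets_band QB)
  moreover have "AE w in P. \<forall>v\<in>{v\<in>V. fst v \<noteq> {}}. X (Q v) w \<le> X F w"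
  proof (subst AE_ball_countable)
    show "countable {v \<in> V. fst v \<noteq> {}}" by (rule countable_subset[OF _ V]) auto
    show "\<forall>v\<in>{v \<in> V. fst v \<noteq> {}}. AE w in P. X (Q v) w \<le> X F w"
      by (intro ballI AE_X_mono Q F(1) QF) auto
  qed
  moreover have "AE w in P. X {} w = 0"
    by (intro AE_X_null) auto
  ultimately have "AE w in P. w \<in> ?event \<longrightarrow> w \<in> (\<Union>s\<in>S. E s)"
  proof eventually_elim
    case (elim w)
    show ?case
    proof
      assume w: "w \<in> ?event"
      then obtain j where j: "j \<in> J" "ennreal y < (\<Prod>i<k. X (A j i) w)" by auto
      have "(\<Prod>i<k. X (A j i) w) = (\<Prod>i<k. SUP v\<in>W j i. X (Q v) w)"
        using elim(1) j(1) by (intro prod.cong) auto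
      then obtain s where s: "s \<in> Pi\<^sub>E {..<k} (W j)" "ennreal y < (\<Prod>i<k. X (Q (s i)) w)"
        using j(2) less_prod_SUPD[of "ennreal y" 1 "\<lambda>i v. X (Q v) w" "W j" k] by auto
      have sV: "s i \<in> V" "(j, i) \<in> fst (s i)" if "i < k" for i
        using s(1) that by (auto simp: W_def PiE_def Pi_def)
      \<comment> \<open>A code used in two coordinates belongs to a point common to two disjoint sides of the
        rectangle \<open>j\<close>, so its atom is empty.\<close>
      have "inj_on s {..<k}"
      proof (rule inj_onI, rule ccontr)
        fix i i' assume i: "i \<in> {..<k}" "i' \<in> {..<k}" "s i = s i'" "i \<noteq> i'"
        then have "Q (s i) \<subseteq> A j i \<inter> A j i'"
          using sV[of i] sV[of i'] QA[of j i "s i"] QA[of j i' "s i"] by auto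
        also have "\<dots> = {}" using disj[OF j(1)] i by (auto simp: disjoint_family_on_def)
        finally have "X (Q (s i)) w = 0" using elim(4) by simp
        then have "(\<Prod>i<k. X (Q (s i)) w) = 0" using i(1) by (intro prod_zero) auto
        with s(2) show False by (metis not_less_zero)
      qed
      then have "s \<in> S" using s(1) sV j(1) by (auto simp: S_def PiE_def Pi_def)
      moreover have "X (Q (s i)) w \<le> ennreal (\<kappa> (s i) powr (1 / \<alpha>))" if "i < k" for i
      proof -
        have "X (Q (s i)) w \<le> ennreal ((R * exp (of_int (snd (s i)) + 1)) powr (1 / \<alpha>))"
          using elim(2) sV(1)[OF that] w by (auto simp: good_def intro: order_trans)
        moreover have "X (Q (s i)) w \<le> ennreal (K powr (1 / \<alpha>))"
        proof -
          have "s i \<in> {v \<in> V. fst v \<noteq> {}}" using sV[OF that] by auto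
          with elim(3) have "X (Q (s i)) w \<le> X F w" by blast
          then show ?thesis using w by auto
        qed
        ultimately show ?thesis by (auto simp: \<kappa>_def min_def)
      qed
      ultimately show "w \<in> (\<Union>s\<in>S. E s)" using w s(2) by (auto simp: E_def)
    qed
  qed
  then have "emeasure P ?event \<le> emeasure P (\<Union>s\<in>S. E s)"
    by (intro emeasure_mono_AE sets.countable_UN' S) auto
  also have "\<dots> \<le> (\<integral>\<^sup>+ s. emeasure P (E s) \<partial>count_space S)"
    by (intro emeasure_UN_countable_le S) auto
  also have "\<dots> \<le> (\<integral>\<^sup>+ s. emeasure ?D (Pi\<^sub>E {..<k} (\<lambda>i. Q (s i))) \<partial>count_space S)"
  proof (rule nn_integral_mono)
    fix s assume "s \<in> space (count_space S)"
    then have s: "\<And>i. i < k \<Longrightarrow> s i \<in> V" "inj_on s {..<k}" "\<And>i. i < k \<Longrightarrow> fst (s i) \<noteq> {}"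
      by (auto simp: S_def PiE_def Pi_def)
    let ?R = "Pi\<^sub>E {..<k} (\<lambda>i. Q (s i))"
    let ?t = "log_tail \<alpha> k y (\<Prod>i<k. \<kappa> (s i))"
    have R [measurable]: "?R \<in> sets (power_measure k \<mu>)" by (intro sets_PiM_I_finite) auto
    have fin: "emeasure \<mu> (Q (s i)) < \<infinity>" if "i < k" for i
      using emeasure_mono[OF QF[OF s(1,3)[OF that]] F(1)] F(2) by (simp add: le_less_trans)
    have "disjoint_family_on (\<lambda>i. Q (s i)) {..<k}"
      using s(2) by (auto simp: disjoint_family_on_def Q_def inj_on_def)
    then have "prob (E s) \<le> (\<Prod>i<k. measure \<mu> (Q (s i))) * y powr (- \<alpha>)
        * (1 + ln (max 1 ((\<Prod>i<k. \<kappa> (s i)) * y powr (- \<alpha>)))) ^ (k - 1)"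
      unfolding E_def using fin pos \<open>0 < k\<close>
      by (intro prob_rectangle_greater_le) (auto simp: \<kappa>_def)
    then have "emeasure P (E s) \<le> ennreal (?t * (\<Prod>i<k. measure \<mu> (Q (s i))))"
      unfolding emeasure_eq_measure by (intro ennreal_leI) (simp add: log_tail_def mult_ac)
    also have "\<dots> = ennreal ?t * (\<Prod>i<k. emeasure \<mu> (Q (s i)))"
    proof -
      have "(\<Prod>i<k. emeasure \<mu> (Q (s i))) = (\<Prod>i<k. ennreal (measure \<mu> (Q (s i))))"
        using fin by (intro prod.cong emeasure_eq_ennreal_measure) (auto simp: less_top)
      then show ?thesis
        by (simp add: prod_ennreal ennreal_mult log_tail_nonneg prod_nonneg)
    qed
    also have "(\<Prod>i<k. emeasure \<mu> (Q (s i))) = emeasure (power_measure k \<mu>) ?R"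
      by (rule emeasure_PiM[symmetric]) auto
    also have "ennreal ?t * \<dots> = (\<integral>\<^sup>+ u. ennreal ?t * indicator ?R u \<partial>power_measure k \<mu>)"
      by (rule nn_integral_cmult_indicator[symmetric]) (rule R)
    also have "\<dots> \<le> (\<integral>\<^sup>+ u. ennreal (capped_weight k y R K u) * indicator ?R u \<partial>power_measure k \<mu>)"
    proof (rule nn_integral_mono)
      fix u
      show "ennreal ?t * indicator ?R u \<le> ennreal (capped_weight k y R K u) * indicator ?R u"
      proof (cases "u \<in> ?R")
        case True
        have u: "exp (of_int (snd (s i))) \<le> g (u i)" if "i < k" for i
        proof -
          have "u i \<in> Q (s i)" using True that by (auto simp: PiE_def Pi_def)
          then have "u i \<in> band (snd (s i))" using QB by blast
          then show ?thesis by (rule g_band)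
        qed
        have "(\<Prod>i<k. \<kappa> (s i)) \<le> (\<Prod>i<k. R * exp 1 * g (u i))"
          using u pos by (intro prod_mono) (auto simp: \<kappa>_def min_le_iff_disj exp_add mult.commute)
        moreover have "(\<Prod>i<k. \<kappa> (s i)) \<le> (\<Prod>i<k. K)"
          using pos by (intro prod_mono) (auto simp: \<kappa>_def)
        ultimately have "?t \<le> capped_weight k y R K u"
          unfolding capped_weight_def by (intro log_tail_mono) (simp add: prod.distrib)
        then show ?thesis by (intro mult_right_mono ennreal_leI) auto
      qed simp
    qed
    also have "\<dots> = emeasure ?D ?R" by (intro emeasure_density[symmetric]) auto
    finally show "emeasure P (E s) \<le> emeasure ?D ?R" .
  qed
  also have "\<dots> = emeasure ?D (\<Union>s\<in>S. Pi\<^sub>E {..<k} (\<lambda>i. Q (s i)))"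
  proof (rule emeasure_UN_countable[symmetric, OF _ S])
    show "Pi\<^sub>E {..<k} (\<lambda>i. Q (s i)) \<in> sets ?D" if "s \<in> S" for s
      unfolding sets_density by (intro sets_PiM_I_finite) auto
    show "disjoint_family_on (\<lambda>s. Pi\<^sub>E {..<k} (\<lambda>i. Q (s i))) S"
    proof (unfold disjoint_family_on_def, intro ballI impI equals0I)
      fix s s' u assume s: "s \<in> S" "s' \<in> S" "s \<noteq> s'"
        and u: "u \<in> Pi\<^sub>E {..<k} (\<lambda>i. Q (s i)) \<inter> Pi\<^sub>E {..<k} (\<lambda>i. Q (s' i))"
      have "s i = code (u i)" "s' i = code (u i)" if "i < k" for i
      proof -
        have "u i \<in> Q (s i)" "u i \<in> Q (s' i)" using u that by (auto simp: PiE_iff)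
        then show "s i = code (u i)" "s' i = code (u i)" by (simp_all add: Q_def)
      qed
      moreover have "s \<in> Pi\<^sub>E {..<k} (\<lambda>_. V)" "s' \<in> Pi\<^sub>E {..<k} (\<lambda>_. V)"
        using s(1,2) unfolding S_def by blast+
      ultimately have "s = s'" by (intro PiE_ext[of s "{..<k}" "\<lambda>_. V" s']) simp_all
      then show False using s by simp
    qed
  qed
  also have "\<dots> \<le> emeasure ?D (\<Union>j\<in>J. Pi\<^sub>E {..<k} (A j))"
  proof (rule emeasure_mono)
    show "(\<Union>s\<in>S. Pi\<^sub>E {..<k} (\<lambda>i. Q (s i))) \<subseteq> (\<Union>j\<in>J. Pi\<^sub>E {..<k} (A j))"
    proof safe
      fix s u assume "s \<in> S" and u: "u \<in> Pi\<^sub>E {..<k} (\<lambda>i. Q (s i))"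
      then obtain j where j: "j \<in> J" "\<And>i. i < k \<Longrightarrow> (j, i) \<in> fst (s i)" by (auto simp: S_def)
      have "Pi\<^sub>E {..<k} (\<lambda>i. Q (s i)) \<subseteq> Pi\<^sub>E {..<k} (A j)"
        by (intro PiE_mono QA j(2)) simp
      with u have "u \<in> Pi\<^sub>E {..<k} (A j)" by blast
      then show "u \<in> (\<Union>j\<in>J. Pi\<^sub>E {..<k} (A j))" using j(1) by blast
    qed
    show "(\<Union>j\<in>J. Pi\<^sub>E {..<k} (A j)) \<in> sets ?D"
      unfolding sets_density by (intro sets.finite_UN J sets_PiM_I_finite A) simp_all
  qed
  finally show ?thesis .
qed

end

section \<open>Tails of the product sup measure\<close>

lemma borel_measurable_ennreal_powr: "(\<lambda>x. ennreal_powr x p) \<in> borel_measurable borel"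
  unfolding ennreal_powr_def by measurable

lemma ennreal_le_ennreal_powr:
  assumes "ennreal z \<le> x" "0 \<le> z" "0 < p"
  shows "ennreal (z powr p) \<le> ennreal_powr x p"
proof (cases x)
  case (real r)
  then have "z \<le> r" using assms by simp
  then show ?thesis using real assms by (auto simp: ennreal_powr_def intro!: ennreal_leI powr_mono2)
qed (simp add: ennreal_powr_def)

lemma emeasure_far_le:
  assumes U: "U \<in> borel_measurable M" and V: "V \<in> borel_measurable M" and "0 < z" "0 < p"
  shows "emeasure M {w \<in> space M. ennreal z \<le> (U w - V w) + (V w - U w)}
    \<le> ennreal (z powr (- p)) * (\<integral>\<^sup>+ w. ennreal_powr ((U w - V w) + (V w - U w)) p \<partial>M)"
proof -
  let ?d = "\<lambda>w. ennreal_powr ((U w - V w) + (V w - U w)) p"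
  have d: "?d \<in> borel_measurable M"
    using U V by (intro measurable_compose[OF _ borel_measurable_ennreal_powr] borel_measurable_add
      borel_measurable_minus_ennreal)
  have "{w \<in> space M. ennreal z \<le> (U w - V w) + (V w - U w)}
      \<subseteq> {w \<in> space M. 1 \<le> ennreal (z powr (- p)) * ?d w}"
  proof safe
    fix w assume "ennreal z \<le> (U w - V w) + (V w - U w)"
    then have "ennreal (z powr p) \<le> ?d w"
      using assms by (intro ennreal_le_ennreal_powr) auto
    then have "ennreal (z powr (- p)) * ennreal (z powr p) \<le> ennreal (z powr (- p)) * ?d w"
      by (rule mult_left_mono) simp
    moreover have "ennreal (z powr (- p)) * ennreal (z powr p) = 1"
      using \<open>0 < z\<close> by (simp flip: ennreal_mult powr_add)
    ultimately show "1 \<le> ennreal (z powr (- p)) * ?d w" by simp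
  qed
  moreover have "{w \<in> space M. 1 \<le> ennreal (z powr (- p)) * ?d w} \<in> sets M"
    using d by measurable
  ultimately have "emeasure M {w \<in> space M. ennreal z \<le> (U w - V w) + (V w - U w)}
      \<le> emeasure M {w \<in> space M. 1 \<le> ennreal (z powr (- p)) * ?d w}"
    by (rule emeasure_mono)
  also have "\<dots> \<le> ennreal (z powr (- p)) * (\<integral>\<^sup>+ w. ?d w * indicator (space M) w \<partial>M)"
    using d by (intro nn_integral_Markov_inequality) auto
  also have "(\<integral>\<^sup>+ w. ?d w * indicator (space M) w \<partial>M) = (\<integral>\<^sup>+ w. ?d w \<partial>M)"
    by (intro nn_integral_cong) simp
  finally show ?thesis .
qed

lemma product_sup_measure_finiteD:
  assumes "product_sup_measure_finite P \<nu> \<alpha> k X Z"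
  shows product_sup_measure_finite_measurable:
      "\<And>A. A \<in> sets (off_diagonal k \<nu>) \<Longrightarrow> Z A \<in> borel_measurable P"
    and product_sup_measure_finite_rectangle:
      "\<And>A. (\<And>i. i < k \<Longrightarrow> A i \<in> sets \<nu>) \<Longrightarrow> disjoint_family_on A {..<k} \<Longrightarrow>
        AE w in P. Z (Pi\<^sub>E {..<k} A) w = (\<Prod>i<k. X (A i) w)"
    and product_sup_measure_finite_union:
      "\<And>(n :: nat) B. (\<And>i. i < n \<Longrightarrow> off_diagonal_rectangle k \<nu> (B i)) \<Longrightarrow>
        AE w in P. Z (\<Union>i<n. B i) w = (SUP i\<in>{..<n}. Z (B i) w)"
    and product_sup_measure_finite_approx:
      "\<And>A. A \<in> sets (off_diagonal k \<nu>) \<Longrightarrow> \<exists>C :: nat \<Rightarrow> (nat \<Rightarrow> 'e) set.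
        (\<forall>n. finite_rectangle_union k \<nu> (C n)) \<and>
        (\<lambda>n. emeasure (power_measure k \<nu>) (sym_diff (C n) A)) \<longlonglongrightarrow> 0 \<and>
        (\<forall>\<gamma>. 0 < \<gamma> \<longrightarrow> \<gamma> < \<alpha> \<longrightarrow> L_limit P \<gamma> (\<lambda>n. Z (C n)) (Z A))"
  using assms unfolding product_sup_measure_finite_def by simp_all

text \<open>On finite unions of rectangles the product sup measure is an explicit function of the underlying
random sup measure, so that tail bounds can be read off from the latter.\<close>

lemma product_sup_measure_finite_AE_eq:
  fixes A :: "nat \<Rightarrow> nat \<Rightarrow> 'e set"
  assumes "product_sup_measure_finite P \<nu> \<alpha> k X Z"
    and A: "\<And>i l. i < n \<Longrightarrow> l < k \<Longrightarrow> A i l \<in> sets \<nu>"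
    and disj: "\<And>i. i < n \<Longrightarrow> disjoint_family_on (A i) {..<k}"
  shows "AE w in P. Z (\<Union>i<n. Pi\<^sub>E {..<k} (A i)) w = (SUP i\<in>{..<n}. \<Prod>l<k. X (A i l) w)"
proof -
  have "AE w in P. Z (\<Union>i<n. Pi\<^sub>E {..<k} (A i)) w = (SUP i\<in>{..<n}. Z (Pi\<^sub>E {..<k} (A i)) w)"
  proof (rule product_sup_measure_finite_union[OF assms(1)])
    show "off_diagonal_rectangle k \<nu> (Pi\<^sub>E {..<k} (A i))" if "i < n" for i
      unfolding off_diagonal_rectangle_def using A[OF that] disj[OF that] by (intro exI[of _ "A i"]) simp
  qed
  moreover have "AE w in P. \<forall>i\<in>{..<n}. Z (Pi\<^sub>E {..<k} (A i)) w = (\<Prod>l<k. X (A i l) w)"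
    by (intro AE_finite_allI product_sup_measure_finite_rectangle[OF assms(1)]) (simp_all add: A disj)
  ultimately show ?thesis
  proof eventually_elim
    case (elim w)
    then show ?case by (auto intro!: SUP_cong)
  qed
qed

lemma product_sup_measure_measurable:
  assumes "product_sup_measure P \<mu> \<alpha> k X Y" "A \<in> sets (off_diagonal k \<mu>)"
  shows "Y A \<in> borel_measurable P"
  using assms unfolding product_sup_measure_def by (elim exE conjE) simp

context frechet_density
begin

text \<open>The limit of \<open>capped_weight\<close> as the cap \<open>K\<close> tends to infinity.\<close>

definition weight :: "nat \<Rightarrow> real \<Rightarrow> real \<Rightarrow> (nat \<Rightarrow> 'e) \<Rightarrow> real" where
  "weight k y R u = log_tail \<alpha> k y ((R * exp 1) ^ k * (\<Prod>i<k. g (u i)))"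

lemma borel_measurable_weight [measurable]:
  "weight k y R \<in> borel_measurable (power_measure k \<mu>)"
  unfolding weight_def[abs_def] by measurable

lemma capped_weight_le:
  "capped_weight k y R K u \<le> weight k y R u" "capped_weight k y R K u \<le> log_tail \<alpha> k y (K ^ k)"
  unfolding capped_weight_def weight_def by (simp_all add: log_tail_mono)

text \<open>The stages \<open>n \<le> N\<close> are treated jointly: all their approximating rectangles, restricted to \<open>E n\<close>, lie
in \<open>E N\<close>, where one cap \<open>K\<close> serves for all of them. Their union exceeds \<open>A\<close> by at most the sum of
the approximation errors, and the capped weight is bounded by its value at \<open>K\<^sup>k\<close>.\<close>

lemma emeasure_approximants_le:
  fixes E :: "nat \<Rightarrow> 'e set"
  assumes "0 < k"
    and E: "\<And>n. E n \<in> sets \<mu>" "\<And>n. emeasure \<mu> (E n) < \<infinity>" "incseq E"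
    and Z: "\<And>n. product_sup_measure_finite P (density \<mu> (indicator (E n))) \<alpha> k
                (\<lambda>A. X (A \<inter> E n)) (Z n)"
    and C: "\<And>n. finite_rectangle_union k (density \<mu> (indicator (E n))) (C n)"
    and A: "A \<in> sets (power_measure k \<mu>)"
    and pos: "0 < R" "0 < K" "0 < y"
  shows "emeasure P {w \<in> space P. w \<in> good R \<and> X (E N) w \<le> ennreal (K powr (1 / \<alpha>))
            \<and> (\<exists>n\<le>N. ennreal y < Z n (C n) w)}
      \<le> (\<integral>\<^sup>+ u. ennreal (weight k y R u) * indicator A u \<partial>power_measure k \<mu>)
        + ennreal (log_tail \<alpha> k y (K ^ k))
          * (\<Sum>n\<le>N. emeasure (power_measure k (density \<mu> (indicator (E n)))) (sym_diff (C n) A))"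
proof -
  let ?c = "ennreal (log_tail \<alpha> k y (K ^ k))"
  let ?M = "power_measure k \<mu>"
  let ?D = "density ?M (\<lambda>u. ennreal (capped_weight k y R K u))"
  let ?rect = "\<lambda>n (p :: nat \<times> (nat \<Rightarrow> nat \<Rightarrow> 'e set)). (\<forall>i<fst p. (\<forall>l<k. snd p i l \<in> sets \<mu>) \<and> disjoint_family_on (snd p i) {..<k})
      \<and> C n = (\<Union>i<fst p. Pi\<^sub>E {..<k} (snd p i))"
  have "\<exists>p. ?rect n p" for n
    using finite_rectangle_unionD[OF C[of n]] by (simp only: split_paired_Ex fst_conv snd_conv sets_density)
  then have "\<forall>n. \<exists>p. ?rect n p" ..
  from choice[OF this] obtain p where "\<forall>n. ?rect n (p n)" ..
  moreover define b where "b n = fst (p n)" for n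
  moreover define B where "B n = snd (p n)" for n
  ultimately have B: "\<And>n i l. i < b n \<Longrightarrow> l < k \<Longrightarrow> B n i l \<in> sets \<mu>"
    and disj: "\<And>n i. i < b n \<Longrightarrow> disjoint_family_on (B n i) {..<k}"
    and CB: "\<And>n. C n = (\<Union>i<b n. Pi\<^sub>E {..<k} (B n i))"
    by simp_all
  define J where "J = (SIGMA n:{..N}. {..<b n})"
  define A' where "A' p l = B (fst p) (snd p) l \<inter> E (fst p)" for p l
  define U where "U = (\<Union>p\<in>J. Pi\<^sub>E {..<k} (A' p))"
  have A': "A' p l \<in> sets \<mu>" if "p \<in> J" "l < k" for p l
    using that B E(1) by (auto simp: J_def A'_def)
  have Cm: "C n \<in> sets ?M" for n
    unfolding CB by (intro sets.finite_UN sets_PiM_I_finite B) simp_all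
  have U: "U \<in> sets ?M"
    unfolding U_def by (intro sets.finite_UN sets_PiM_I_finite A') (simp_all add: J_def)
  have "AE w in P. \<forall>n. Z n (C n) w = (SUP i\<in>{..<b n}. \<Prod>l<k. X (B n i l \<inter> E n) w)"
    unfolding AE_all_countable CB
    by (intro allI product_sup_measure_finite_AE_eq[OF Z] disj) (auto simp: B)
  then have "AE w in P. w \<in> {w \<in> space P. w \<in> good R \<and> X (E N) w \<le> ennreal (K powr (1 / \<alpha>))
            \<and> (\<exists>n\<le>N. ennreal y < Z n (C n) w)}
      \<longrightarrow> w \<in> {w \<in> space P. w \<in> good R \<and> X (E N) w \<le> ennreal (K powr (1 / \<alpha>))
            \<and> (\<exists>p\<in>J. ennreal y < (\<Prod>l<k. X (A' p l) w))}"
    by eventually_elim (auto simp: J_def A'_def less_SUP_iff)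
  then have "emeasure P {w \<in> space P. w \<in> good R \<and> X (E N) w \<le> ennreal (K powr (1 / \<alpha>))
            \<and> (\<exists>n\<le>N. ennreal y < Z n (C n) w)}
      \<le> emeasure P {w \<in> space P. w \<in> good R \<and> X (E N) w \<le> ennreal (K powr (1 / \<alpha>))
            \<and> (\<exists>p\<in>J. ennreal y < (\<Prod>l<k. X (A' p l) w))}"
  proof (rule emeasure_mono_AE)
    have J: "finite J" by (simp add: J_def)
    have "{w \<in> space P. \<exists>p\<in>J. ennreal y < (\<Prod>l<k. X (A' p l) w)} \<in> sets P"
    proof (rule sets.sets_Collect_finite_Ex[OF _ J])
      fix p assume p: "p \<in> J"
      have "(\<lambda>w. \<Prod>l<k. X (A' p l) w) \<in> borel_measurable P"
        by (intro borel_measurable_prod_ennreal X_measurable A' p) simp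
      then show "{w \<in> space P. ennreal y < (\<Prod>l<k. X (A' p l) w)} \<in> sets P"
        by measurable
    qed
    moreover have "{w \<in> space P. X (E N) w \<le> ennreal (K powr (1 / \<alpha>))} \<in> sets P"
      using X_measurable[OF E(1)[of N]] by measurable
    ultimately have "good R \<inter> ({w \<in> space P. X (E N) w \<le> ennreal (K powr (1 / \<alpha>))}
        \<inter> {w \<in> space P. \<exists>p\<in>J. ennreal y < (\<Prod>l<k. X (A' p l) w)}) \<in> sets P"
      using sets_good by blast
    also have "good R \<inter> ({w \<in> space P. X (E N) w \<le> ennreal (K powr (1 / \<alpha>))}
        \<inter> {w \<in> space P. \<exists>p\<in>J. ennreal y < (\<Prod>l<k. X (A' p l) w)})
        = {w \<in> space P. w \<in> good R \<and> X (E N) w \<le> ennreal (K powr (1 / \<alpha>))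
            \<and> (\<exists>p\<in>J. ennreal y < (\<Prod>l<k. X (A' p l) w))}" by blast
    finally show "{w \<in> space P. w \<in> good R \<and> X (E N) w \<le> ennreal (K powr (1 / \<alpha>))
            \<and> (\<exists>p\<in>J. ennreal y < (\<Prod>l<k. X (A' p l) w))} \<in> sets P" .
  qed
  also have "\<dots> \<le> emeasure ?D U"
    unfolding U_def
  proof (rule emeasure_rectangles_le)
    show "finite J" by (simp add: J_def)
    show "A' p i \<subseteq> E N" if "p \<in> J" for p i
      using that incseqD[OF E(3), of "fst p" N] by (auto simp: J_def A'_def)
    show "disjoint_family_on (A' p) {..<k}" if "p \<in> J" for p
    proof -
      have "disjoint_family_on (B (fst p) (snd p)) {..<k}"
        using that by (intro disj) (auto simp: J_def)
      then show ?thesis unfolding disjoint_family_on_def A'_def by blast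
    qed
  qed (use A' E pos \<open>0 < k\<close> in auto)
  also have "\<dots> \<le> emeasure ?D (A \<union> (U - A))"
    using A U by (intro emeasure_mono) auto
  also have "\<dots> \<le> emeasure ?D A + emeasure ?D (U - A)"
    using A U by (intro emeasure_subadditive) auto
  also have "emeasure ?D A = (\<integral>\<^sup>+ u. ennreal (capped_weight k y R K u) * indicator A u \<partial>?M)"
    using A by (intro emeasure_density) auto
  also have "\<dots> \<le> (\<integral>\<^sup>+ u. ennreal (weight k y R u) * indicator A u \<partial>?M)"
    by (intro nn_integral_mono mult_right_mono ennreal_leI capped_weight_le) simp
  also have "emeasure ?D (U - A) = (\<integral>\<^sup>+ u. ennreal (capped_weight k y R K u) * indicator (U - A) u \<partial>?M)"
    using A U by (intro emeasure_density) auto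
  also have "\<dots> \<le> (\<integral>\<^sup>+ u. ?c * indicator (U - A) u \<partial>?M)"
    by (intro nn_integral_mono mult_right_mono ennreal_leI capped_weight_le) simp
  also have "\<dots> = ?c * emeasure ?M (U - A)"
    using A U by (intro nn_integral_cmult_indicator) auto
  also have "emeasure ?M (U - A) \<le> emeasure ?M (\<Union>n\<in>{..N}. sym_diff (C n) A \<inter> Pi\<^sub>E {..<k} (\<lambda>_. E n))"
  proof (rule emeasure_mono)
    have sub: "Pi\<^sub>E {..<k} (A' p) \<subseteq> C (fst p) \<inter> Pi\<^sub>E {..<k} (\<lambda>_. E (fst p))" if "p \<in> J" for p
    proof -
      have "Pi\<^sub>E {..<k} (A' p) \<subseteq> Pi\<^sub>E {..<k} (B (fst p) (snd p))"
        by (intro PiE_mono) (simp add: A'_def)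
      also have "\<dots> \<subseteq> C (fst p)"
      proof -
        have "snd p \<in> {..<b (fst p)}" using that by (auto simp: J_def)
        then show ?thesis unfolding CB by (rule UN_upper)
      qed
      finally have "Pi\<^sub>E {..<k} (A' p) \<subseteq> C (fst p)" .
      moreover have "Pi\<^sub>E {..<k} (A' p) \<subseteq> Pi\<^sub>E {..<k} (\<lambda>_. E (fst p))"
        by (intro PiE_mono) (simp add: A'_def)
      ultimately show ?thesis by (rule Int_greatest)
    qed
    show "U - A \<subseteq> (\<Union>n\<in>{..N}. sym_diff (C n) A \<inter> Pi\<^sub>E {..<k} (\<lambda>_. E n))"
    proof
      fix u assume "u \<in> U - A"
      then obtain p where p: "p \<in> J" "u \<in> Pi\<^sub>E {..<k} (A' p)" "u \<notin> A" by (auto simp: U_def)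
      then have "u \<in> sym_diff (C (fst p)) A \<inter> Pi\<^sub>E {..<k} (\<lambda>_. E (fst p))"
        using subsetD[OF sub[OF p(1)] p(2)] by simp
      moreover have "fst p \<in> {..N}" using p(1) by (auto simp: J_def)
      ultimately show "u \<in> (\<Union>n\<in>{..N}. sym_diff (C n) A \<inter> Pi\<^sub>E {..<k} (\<lambda>_. E n))" by blast
    qed
    show "(\<Union>n\<in>{..N}. sym_diff (C n) A \<inter> Pi\<^sub>E {..<k} (\<lambda>_. E n)) \<in> sets ?M"
      using A Cm E(1) by (intro sets.finite_UN sets.Int sets_PiM_I_finite) auto
  qed
  also have "\<dots> \<le> (\<Sum>n\<le>N. emeasure ?M (sym_diff (C n) A \<inter> Pi\<^sub>E {..<k} (\<lambda>_. E n)))"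
    using A Cm E(1) by (intro emeasure_subadditive_finite) (auto intro!: sets_PiM_I_finite)
  also have "\<dots> = (\<Sum>n\<le>N. emeasure (power_measure k (density \<mu> (indicator (E n)))) (sym_diff (C n) A))"
    using A Cm E sigma_finite_mu
    by (intro sum.cong emeasure_power_measure_restrict[symmetric]) auto
  finally show ?thesis by (simp add: add_mono mult_left_mono)
qed

text \<open>If \<open>Z n A > y\<close>, then either the approximant exceeds \<open>y / 2\<close> or it differs from \<open>Z n A\<close> by at least
\<open>y / 2\<close>. The second case has vanishing probability in the limit, and so has the error term of the
first. Replacing \<open>y\<close> by \<open>y / 2\<close> only changes constants.\<close>

lemma emeasure_stage_le:
  fixes E :: "nat \<Rightarrow> 'e set"
  assumes iso: "borel_isomorphic_to_unit_subset \<mu>" and "0 < k"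
    and E: "\<And>n. E n \<in> sets \<mu>" "\<And>n. emeasure \<mu> (E n) < \<infinity>" "incseq E"
    and Z: "\<And>n. product_sup_measure_finite P (density \<mu> (indicator (E n))) \<alpha> k
                (\<lambda>A. X (A \<inter> E n)) (Z n)"
    and A: "A \<in> sets (off_diagonal k \<mu>)"
    and pos: "0 < R" "0 < K" "0 < y"
  shows "emeasure P {w \<in> space P. w \<in> good R \<and> X (E N) w \<le> ennreal (K powr (1 / \<alpha>))
            \<and> (\<exists>n\<le>N. ennreal y < Z n A w)}
      \<le> (\<integral>\<^sup>+ u. ennreal (weight k (y / 2) R u) * indicator A u \<partial>power_measure k \<mu>)"
    (is "emeasure P ?event \<le> ?I")
proof -
  define \<nu> where "\<nu> n = density \<mu> (indicator (E n))" for n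
  \<comment> \<open>Any exponent in \<open>(0, \<alpha>)\<close> would do.\<close>
  define p where "p = \<alpha> / 2"
  have p: "0 < p" "p < \<alpha>" using alpha_pos by (auto simp: p_def)
  have off: "sets (off_diagonal k (\<nu> n)) = sets (off_diagonal k \<mu>)" for n
    by (rule sets_off_diagonal_cong) (simp add: \<nu>_def)
  have "\<exists>C :: nat \<Rightarrow> (nat \<Rightarrow> 'e) set. (\<forall>j. finite_rectangle_union k (\<nu> n) (C j))
      \<and> (\<lambda>j. emeasure (power_measure k (\<nu> n)) (sym_diff (C j) A)) \<longlonglongrightarrow> 0
      \<and> (\<forall>\<gamma>. 0 < \<gamma> \<longrightarrow> \<gamma> < \<alpha> \<longrightarrow> L_limit P \<gamma> (\<lambda>j. Z n (C j)) (Z n A))" for n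
  proof -
    have "A \<in> sets (off_diagonal k (\<nu> n))" using A off by simp
    then show ?thesis by (rule product_sup_measure_finite_approx[OF Z[folded \<nu>_def]])
  qed
  then have "\<forall>n. \<exists>C :: nat \<Rightarrow> (nat \<Rightarrow> 'e) set. (\<forall>j. finite_rectangle_union k (\<nu> n) (C j))
      \<and> (\<lambda>j. emeasure (power_measure k (\<nu> n)) (sym_diff (C j) A)) \<longlonglongrightarrow> 0
      \<and> (\<forall>\<gamma>. 0 < \<gamma> \<longrightarrow> \<gamma> < \<alpha> \<longrightarrow> L_limit P \<gamma> (\<lambda>j. Z n (C j)) (Z n A))" ..
  from choice[OF this] obtain C :: "nat \<Rightarrow> nat \<Rightarrow> (nat \<Rightarrow> 'e) set" where
    "\<forall>n. (\<forall>j. finite_rectangle_union k (\<nu> n) (C n j))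
      \<and> (\<lambda>j. emeasure (power_measure k (\<nu> n)) (sym_diff (C n j) A)) \<longlonglongrightarrow> 0
      \<and> (\<forall>\<gamma>. 0 < \<gamma> \<longrightarrow> \<gamma> < \<alpha> \<longrightarrow> L_limit P \<gamma> (\<lambda>j. Z n (C n j)) (Z n A))" ..
  then have C: "\<And>n j. finite_rectangle_union k (\<nu> n) (C n j)"
    and lim: "\<And>n. (\<lambda>j. emeasure (power_measure k (\<nu> n)) (sym_diff (C n j) A)) \<longlonglongrightarrow> 0"
    and Llim: "\<And>n. (\<lambda>j. \<integral>\<^sup>+ w. ennreal_powr ((Z n (C n j) w - Z n A w) + (Z n A w - Z n (C n j) w)) p \<partial>P) \<longlonglongrightarrow> 0"
    using p by (simp_all add: L_limit_def)
  have Zm: "Z n S \<in> borel_measurable P" if "S \<in> sets (off_diagonal k \<mu>)" for n S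
    using that off by (intro product_sup_measure_finite_measurable[OF Z[folded \<nu>_def]]) simp
  have Cm: "C n j \<in> sets (off_diagonal k \<mu>)" for n j
    using finite_rectangle_union_in_off_diagonal[OF C[of n j]] off by simp
  define far where "far n j = {w \<in> space P. ennreal (y / 2)
      \<le> (Z n (C n j) w - Z n A w) + (Z n A w - Z n (C n j) w)}" for n j
  define near where "near j = {w \<in> space P. w \<in> good R \<and> X (E N) w \<le> ennreal (K powr (1 / \<alpha>))
            \<and> (\<exists>n\<le>N. ennreal (y / 2) < Z n (C n j) w)}" for j
  have far_m: "far n j \<in> sets P" for n j
    unfolding far_def using Zm[OF Cm[of n j], of n] Zm[OF A, of n] by measurable
  have near_m: "near j \<in> sets P" for j
  proof -
    have "{w \<in> space P. X (E N) w \<le> ennreal (K powr (1 / \<alpha>))} \<in> sets P"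
      using X_measurable[OF E(1)[of N]] by measurable
    moreover have "{w \<in> space P. ennreal (y / 2) < Z n (C n j) w} \<in> sets P" for n
      using Zm[OF Cm[of n j], of n] by measurable
    then have "(\<Union>n\<in>{..N}. {w \<in> space P. ennreal (y / 2) < Z n (C n j) w}) \<in> sets P"
      by (intro sets.finite_UN) auto
    ultimately have "good R \<inter> ({w \<in> space P. X (E N) w \<le> ennreal (K powr (1 / \<alpha>))}
        \<inter> (\<Union>n\<in>{..N}. {w \<in> space P. ennreal (y / 2) < Z n (C n j) w})) \<in> sets P"
      using sets_good by (intro sets.Int)
    also have "good R \<inter> ({w \<in> space P. X (E N) w \<le> ennreal (K powr (1 / \<alpha>))}
        \<inter> (\<Union>n\<in>{..N}. {w \<in> space P. ennreal (y / 2) < Z n (C n j) w})) = near j"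
      unfolding near_def by auto
    finally show ?thesis .
  qed
  have bound: "emeasure P ?event \<le> ?I
      + (ennreal (log_tail \<alpha> k (y / 2) (K ^ k))
          * (\<Sum>n\<le>N. emeasure (power_measure k (\<nu> n)) (sym_diff (C n j) A))
        + (\<Sum>n\<le>N. ennreal ((y / 2) powr (- p))
            * (\<integral>\<^sup>+ w. ennreal_powr ((Z n (C n j) w - Z n A w) + (Z n A w - Z n (C n j) w)) p \<partial>P)))" for j
  proof -
    have "?event \<subseteq> near j \<union> (\<Union>n\<in>{..N}. far n j)"
    proof
      fix w assume w: "w \<in> ?event"
      then obtain n where n: "n \<le> N" "ennreal y < Z n A w" by auto
      show "w \<in> near j \<union> (\<Union>n\<in>{..N}. far n j)"
      proof (cases "ennreal (y / 2) < Z n (C n j) w")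
        case True
        then show ?thesis using w n(1) by (auto simp: near_def)
      next
        case False
        have "ennreal (y / 2) = ennreal y - ennreal (y / 2)"
          using pos by (subst ennreal_minus) auto
        also have "\<dots> \<le> Z n A w - Z n (C n j) w"
          using n(2) False by (intro ennreal_minus_mono) auto
        also have "\<dots> \<le> (Z n (C n j) w - Z n A w) + (Z n A w - Z n (C n j) w)" by simp
        finally show ?thesis using w n(1) by (auto simp: far_def)
      qed
    qed
    then have "emeasure P ?event \<le> emeasure P (near j \<union> (\<Union>n\<in>{..N}. far n j))"
      using near_m far_m by (intro emeasure_mono sets.Un sets.finite_UN) auto
    also have "\<dots> \<le> emeasure P (near j) + emeasure P (\<Union>n\<in>{..N}. far n j)"
      using near_m far_m by (intro emeasure_subadditive sets.finite_UN) auto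
    also have "emeasure P (\<Union>n\<in>{..N}. far n j) \<le> (\<Sum>n\<le>N. emeasure P (far n j))"
      using far_m by (intro emeasure_subadditive_finite) auto
    also have "\<dots> \<le> (\<Sum>n\<le>N. ennreal ((y / 2) powr (- p))
            * (\<integral>\<^sup>+ w. ennreal_powr ((Z n (C n j) w - Z n A w) + (Z n A w - Z n (C n j) w)) p \<partial>P))"
      unfolding far_def using pos p(1) by (intro sum_mono emeasure_far_le Zm Cm A) auto
    also have "emeasure P (near j) \<le> ?I + ennreal (log_tail \<alpha> k (y / 2) (K ^ k))
          * (\<Sum>n\<le>N. emeasure (power_measure k (\<nu> n)) (sym_diff (C n j) A))"
      unfolding near_def \<nu>_def
    proof (rule emeasure_approximants_le[OF \<open>0 < k\<close> E Z])
      show "finite_rectangle_union k (density \<mu> (indicator (E n))) (C n j)" for n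
        using C[of n j] by (simp add: \<nu>_def)
      show "A \<in> sets (power_measure k \<mu>)" by (rule sets_power_measure_if_off_diagonal[OF iso A])
    qed (use pos in auto)
    finally show ?thesis by (simp add: add.assoc)
  qed
  have "(\<lambda>j. ?I + (ennreal (log_tail \<alpha> k (y / 2) (K ^ k))
          * (\<Sum>n\<le>N. emeasure (power_measure k (\<nu> n)) (sym_diff (C n j) A))
        + (\<Sum>n\<le>N. ennreal ((y / 2) powr (- p))
            * (\<integral>\<^sup>+ w. ennreal_powr ((Z n (C n j) w - Z n A w) + (Z n A w - Z n (C n j) w)) p \<partial>P))))
      \<longlonglongrightarrow> ?I + (ennreal (log_tail \<alpha> k (y / 2) (K ^ k)) * (\<Sum>n\<le>N. 0)
        + (\<Sum>n\<le>N. ennreal ((y / 2) powr (- p)) * 0))"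
    by (intro tendsto_add tendsto_const ennreal_tendsto_cmult tendsto_sum lim Llim) auto
  then have "emeasure P ?event \<le> ?I + (ennreal (log_tail \<alpha> k (y / 2) (K ^ k)) * (\<Sum>n\<le>N. 0)
        + (\<Sum>n\<le>N. ennreal ((y / 2) powr (- p)) * 0))"
    using bound by (intro LIMSEQ_le_const) auto
  then show ?thesis by simp
qed

text \<open>The bound of \<open>emeasure_stage_le\<close> depends neither on the cap \<open>K\<close> nor on the stage \<open>N\<close>, and the events
increase in both. They exhaust the event in question since \<open>X (E N)\<close> is finite almost surely.\<close>

lemma emeasure_product_sup_measure_le:
  assumes iso: "borel_isomorphic_to_unit_subset \<mu>" and "0 < k"
    and Y: "product_sup_measure P \<mu> \<alpha> k X Y"
    and A: "A \<in> sets (off_diagonal k \<mu>)"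
    and pos: "0 < R" "0 < y"
  shows "emeasure P {w \<in> space P. w \<in> good R \<and> ennreal y < Y A w}
      \<le> (\<integral>\<^sup>+ u. ennreal (weight k (y / 2) R u) * indicator A u \<partial>power_measure k \<mu>)"
    (is "_ \<le> ?I")
proof -
  obtain E :: "nat \<Rightarrow> 'e set" and Z where
    EZ: "range E \<subseteq> sets \<mu>" "incseq E" "\<forall>n. 0 < emeasure \<mu> (E n) \<and> emeasure \<mu> (E n) < \<infinity>"
      "\<forall>n. product_sup_measure_finite P (density \<mu> (indicator (E n))) \<alpha> k (\<lambda>A. X (A \<inter> E n)) (Z n)"
      "\<forall>A\<in>sets (off_diagonal k \<mu>). Y A \<in> borel_measurable P \<and> (AE w in P. Y A w = (SUP n. Z n A w))"
    using Y unfolding product_sup_measure_def by (elim exE conjE) (rule that, assumption+)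
  have E: "\<And>n. E n \<in> sets \<mu>" "incseq E" "\<And>n. emeasure \<mu> (E n) < \<infinity>"
    using EZ(1-3) by auto
  have Z: "\<And>n. product_sup_measure_finite P (density \<mu> (indicator (E n))) \<alpha> k
                (\<lambda>A. X (A \<inter> E n)) (Z n)"
    using EZ(4) ..
  have YZ: "AE w in P. Y A w = (SUP n. Z n A w)"
    using bspec[OF EZ(5) A] ..
  have Zm: "Z n A \<in> borel_measurable P" for n
  proof -
    have "A \<in> sets (off_diagonal k (density \<mu> (indicator (E n))))"
      using A sets_off_diagonal_cong[of "density \<mu> (indicator (E n))" \<mu> k] by simp
    then show ?thesis by (rule product_sup_measure_finite_measurable[OF Z])
  qed
  define S where "S N K = {w \<in> space P. w \<in> good R \<and> X (E N) w \<le> ennreal (real (Suc K) powr (1 / \<alpha>))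
            \<and> (\<exists>n\<le>N. ennreal y < Z n A w)}" for N K
  define S' where "S' N = {w \<in> space P. w \<in> good R \<and> (\<exists>n\<le>N. ennreal y < Z n A w)}" for N
  have U: "(\<Union>n\<in>{..N}. {w \<in> space P. ennreal y < Z n A w}) \<in> sets P" for N
  proof (intro sets.finite_UN)
    show "{w \<in> space P. ennreal y < Z n A w} \<in> sets P" for n using Zm[of n] by measurable
  qed simp
  have S'm: "S' N \<in> sets P" for N
  proof -
    have "S' N = good R \<inter> (\<Union>n\<in>{..N}. {w \<in> space P. ennreal y < Z n A w})"
      unfolding S'_def by auto
    then show ?thesis by (simp only: sets.Int sets_good U)
  qed
  have Sm: "S N K \<in> sets P" for N K
  proof -
    have "S N K = S' N \<inter> {w \<in> space P. X (E N) w \<le> ennreal (real (Suc K) powr (1 / \<alpha>))}"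
      unfolding S_def S'_def by auto
    moreover have "{w \<in> space P. X (E N) w \<le> ennreal (real (Suc K) powr (1 / \<alpha>))} \<in> sets P"
      using X_measurable[OF E(1)[of N]] by measurable
    ultimately show ?thesis by (simp only: sets.Int S'm)
  qed
  have "emeasure P (S' N) \<le> ?I" for N
  proof -
    have "AE w in P. w \<in> S' N \<longrightarrow> w \<in> (\<Union>K. S N K)"
      using AE_X_finite[OF E(1) E(3), of N]
    proof eventually_elim
      case (elim w)
      show ?case
      proof
        assume w: "w \<in> S' N"
        obtain r where r: "X (E N) w = ennreal r" "0 \<le> r" using elim by (cases "X (E N) w") auto
        obtain K where "r powr \<alpha> \<le> real K" using real_arch_simple by blast
        then have "(r powr \<alpha>) powr (1 / \<alpha>) \<le> real (Suc K) powr (1 / \<alpha>)"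
          using alpha_pos by (intro powr_mono2) auto
        then have "r \<le> real (Suc K) powr (1 / \<alpha>)" using r(2) alpha_pos by (simp add: powr_powr)
        then have "X (E N) w \<le> ennreal (real (Suc K) powr (1 / \<alpha>))"
          unfolding r(1) by (rule ennreal_leI)
        then have "w \<in> S N K" using w unfolding S_def S'_def by simp
        then show "w \<in> (\<Union>K. S N K)" by blast
      qed
    qed
    then have "emeasure P (S' N) \<le> emeasure P (\<Union>K. S N K)"
      using Sm by (intro emeasure_mono_AE) auto
    also have "\<dots> \<le> ?I"
    proof (rule emeasure_UN_incseq_le)
      show "incseq (S N)"
      proof (rule incseq_SucI, rule subsetI)
        fix K w assume w: "w \<in> S N K"
        have "real (Suc K) powr (1 / \<alpha>) \<le> real (Suc (Suc K)) powr (1 / \<alpha>)"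
          using alpha_pos by (intro powr_mono2) auto
        then have "ennreal (real (Suc K) powr (1 / \<alpha>)) \<le> ennreal (real (Suc (Suc K)) powr (1 / \<alpha>))"
          by (rule ennreal_leI)
        then show "w \<in> S N (Suc K)" using w unfolding S_def by (auto intro: order_trans)
      qed
      show "emeasure P (S N K) \<le> ?I" for K
        unfolding S_def using pos by (intro emeasure_stage_le[OF iso \<open>0 < k\<close> E(1) E(3) E(2) Z A]) auto
    qed (rule Sm)
    finally show ?thesis .
  qed
  moreover have "incseq S'"
    unfolding S'_def by (rule incseq_SucI) (auto intro: le_SucI)
  ultimately have le: "emeasure P (\<Union>N. S' N) \<le> ?I"
    using S'm by (intro emeasure_UN_incseq_le)
  have "AE w in P. w \<in> {w \<in> space P. w \<in> good R \<and> ennreal y < Y A w} \<longrightarrow> w \<in> (\<Union>N. S' N)"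
    using YZ by eventually_elim (auto simp: S'_def less_SUP_iff)
  then have "emeasure P {w \<in> space P. w \<in> good R \<and> ennreal y < Y A w} \<le> emeasure P (\<Union>N. S' N)"
    using S'm by (intro emeasure_mono_AE) auto
  with le show ?thesis by (rule order_trans[rotated])
qed

lemma emeasure_simple_extremal_integral_le:
  assumes iso: "borel_isomorphic_to_unit_subset \<mu>" and "0 < k"
    and Y: "product_sup_measure P \<mu> \<alpha> k X Y"
    and S: "simple_data k \<mu> N a A" and pos: "0 < R" "0 < x"
  shows "emeasure P {w \<in> space P. w \<in> good R \<and> ennreal x < simple_extremal_integral Y N a A w}
      \<le> (\<integral>\<^sup>+ u. (\<Sum>i<N. ennreal (weight k (x / (2 * a i)) R u) * indicator (A i) u) \<partial>power_measure k \<mu>)"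
proof -
  have a: "0 < a i" and A: "A i \<in> sets (off_diagonal k \<mu>)" if "i < N" for i
    using S that by (auto simp: simple_data_def)
  have Ym: "Y (A i) \<in> borel_measurable P" if "i < N" for i
    using A[OF that] by (rule product_sup_measure_measurable[OF Y])
  let ?B = "\<lambda>i. {w \<in> space P. w \<in> good R \<and> ennreal (x / a i) < Y (A i) w}"
  have B: "?B i \<in> sets P" if "i < N" for i
  proof -
    have "?B i = good R \<inter> {w \<in> space P. ennreal (x / a i) < Y (A i) w}" by auto
    moreover have "{w \<in> space P. ennreal (x / a i) < Y (A i) w} \<in> sets P"
      using Ym[OF that] by measurable
    ultimately show ?thesis by (simp only: sets.Int sets_good)
  qed
  have "{w \<in> space P. w \<in> good R \<and> ennreal x < simple_extremal_integral Y N a A w}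
      \<subseteq> (\<Union>i\<in>{..<N}. ?B i)"
  proof
    fix w assume w: "w \<in> {w \<in> space P. w \<in> good R \<and> ennreal x < simple_extremal_integral Y N a A w}"
    then obtain i where i: "i < N" "ennreal x < ennreal (a i) * Y (A i) w"
      unfolding simple_extremal_integral_def by (auto simp: less_SUP_iff)
    have "\<not> Y (A i) w \<le> ennreal (x / a i)"
    proof
      assume "Y (A i) w \<le> ennreal (x / a i)"
      then have "ennreal (a i) * Y (A i) w \<le> ennreal (a i) * ennreal (x / a i)"
        by (rule mult_left_mono) simp
      also have "\<dots> = ennreal x" using a[OF i(1)] pos by (simp flip: ennreal_mult)
      finally show False using i(2) by simp
    qed
    then have "w \<in> ?B i" using w by (auto simp: not_le)
    then show "w \<in> (\<Union>i\<in>{..<N}. ?B i)" using i(1) by blast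
  qed
  then have "emeasure P {w \<in> space P. w \<in> good R \<and> ennreal x < simple_extremal_integral Y N a A w}
      \<le> emeasure P (\<Union>i\<in>{..<N}. ?B i)"
    using B by (intro emeasure_mono sets.finite_UN) auto
  also have "\<dots> \<le> (\<Sum>i<N. emeasure P (?B i))"
    using B by (intro emeasure_subadditive_finite) auto
  also have "\<dots> \<le> (\<Sum>i<N. \<integral>\<^sup>+ u. ennreal (weight k (x / (2 * a i)) R u) * indicator (A i) u \<partial>power_measure k \<mu>)"
  proof (rule sum_mono)
    fix i assume "i \<in> {..<N}"
    then have i: "i < N" by simp
    show "emeasure P (?B i)
        \<le> (\<integral>\<^sup>+ u. ennreal (weight k (x / (2 * a i)) R u) * indicator (A i) u \<partial>power_measure k \<mu>)"
      using emeasure_product_sup_measure_le[OF iso \<open>0 < k\<close> Y A[OF i], of R "x / a i"] pos a[OF i]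
      by (simp add: mult.commute)
  qed
  also have "\<dots> = (\<integral>\<^sup>+ u. (\<Sum>i<N. ennreal (weight k (x / (2 * a i)) R u) * indicator (A i) u) \<partial>power_measure k \<mu>)"
  proof (rule nn_integral_sum[symmetric])
    fix i assume "i \<in> {..<N}"
    then have "A i \<in> sets (power_measure k \<mu>)"
      using A by (intro sets_power_measure_if_off_diagonal[OF iso]) auto
    then show "(\<lambda>u. ennreal (weight k (x / (2 * a i)) R u) * indicator (A i) u)
        \<in> borel_measurable (power_measure k \<mu>)"
      by measurable
  qed
  finally show ?thesis .
qed

end

section \<open>The \<open>L ln L\<close> condition and finiteness of the integral\<close>

text \<open>With \<open>h = t \<Psi>\<^sup>1\<^sup>/\<^sup>\<alpha>\<close> and \<open>y = x / (2 t)\<close> one has \<open>\<Psi> y\<^sup>-\<^sup>\<alpha> = (2 / x)\<^sup>\<alpha> h\<^sup>\<alpha>\<close>. So the weight of the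
tail bound turns into the integrand of the \<open>L ln L\<close> functional: for \<open>x \<ge> 2\<close> the logarithm is at most
\<open>k (1 + ln R) + \<alpha> ln\<^sub>+ h\<close>.\<close>

lemma log_tail_le_L_ln_L:
  fixes \<alpha> R x t \<Psi> :: real and k :: nat
  assumes "0 < \<alpha>" "1 \<le> R" "2 \<le> x" "0 < t" "0 < \<Psi>"
  defines "h \<equiv> t * \<Psi> powr (1 / \<alpha>)"
  shows "\<Psi> * log_tail \<alpha> k (x / (2 * t)) ((R * exp 1) ^ k * \<Psi>)
    \<le> (2 * (1 + real k + real k * ln R + \<alpha>)) ^ (k - 1) * (2 / x) powr \<alpha>
        * (h powr \<alpha> * (1 + ln (max h 1) ^ (k - 1)))"
proof -
  define D where "D = 1 + real k + real k * ln R + \<alpha>"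
  define L where "L = ln (max h 1)"
  define H where "H = h powr \<alpha>"
  have h: "0 < h" using assms by (simp add: h_def)
  have L: "0 \<le> L" by (simp add: L_def)
  have lnR: "0 \<le> ln R" using assms by simp
  have D: "1 \<le> D" using lnR assms by (simp add: D_def)
  have H: "H = t powr \<alpha> * \<Psi>"
    using assms by (simp add: H_def h_def powr_mult powr_powr)
  have y: "(x / (2 * t)) powr (- \<alpha>) = (2 / x) powr \<alpha> * t powr \<alpha>"
    using assms by (simp add: powr_minus_divide powr_divide powr_mult)
  have x1: "(2 / x) powr \<alpha> \<le> 1"
    using powr_mono2[of \<alpha> "2 / x" 1] assms by simp
  define q where "q = (R * exp 1) ^ k * \<Psi> * (x / (2 * t)) powr (- \<alpha>)"
  have Re: "1 \<le> R * exp 1"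
    using assms by (intro mult_ge1_I[THEN order_trans[rotated]]) auto
  have "q = (R * exp 1) ^ k * ((2 / x) powr \<alpha> * H)"
    by (simp add: q_def y H)
  also have "\<dots> \<le> (R * exp 1) ^ k * (1 * H)"
    using x1 Re by (intro mult_left_mono mult_right_mono) (auto simp: H_def)
  also have "\<dots> \<le> (R * exp 1) ^ k * max h 1 powr \<alpha>"
    using h Re assms(1) by (intro mult_left_mono) (auto simp: H_def intro!: powr_mono2)
  finally have q: "q \<le> (R * exp 1) ^ k * max h 1 powr \<alpha>" .
  have one: "1 \<le> (R * exp 1) ^ k * max h 1 powr \<alpha>"
  proof -
    have "1 * 1 \<le> (R * exp 1) ^ k * max h 1 powr \<alpha>"
      using Re assms(1) by (intro mult_mono one_le_power ge_one_powr_ge_zero) auto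
    then show ?thesis by simp
  qed
  have "ln (max 1 q) \<le> ln ((R * exp 1) ^ k * max h 1 powr \<alpha>)"
    using q one by (intro ln_mono) auto
  also have "\<dots> = ln ((R * exp 1) ^ k) + ln (max h 1 powr \<alpha>)"
    using assms by (intro ln_mult_pos) auto
  also have "\<dots> = k * (ln R + 1) + \<alpha> * L"
    using assms by (simp add: ln_realpow ln_mult_pos ln_powr L_def)
  finally have "1 + ln (max 1 q) \<le> 1 + k * (ln R + 1) + \<alpha> * L" by simp
  also have "\<dots> \<le> D * (1 + L)"
    using L lnR assms by (simp add: D_def algebra_simps)
  \<comment> \<open>\<open>1 + L \<le> 2 max 1 L\<close> makes the power split without binomial coefficients.\<close>
  also have "\<dots> \<le> D * (2 * max 1 L)"
    using D by (intro mult_left_mono) auto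
  finally have "(1 + ln (max 1 q)) ^ (k - 1) \<le> (2 * D * max 1 L) ^ (k - 1)"
    by (intro power_mono) (auto simp: algebra_simps)
  also have "\<dots> = (2 * D) ^ (k - 1) * max 1 L ^ (k - 1)" by (simp add: power_mult_distrib)
  also have "\<dots> \<le> (2 * D) ^ (k - 1) * (1 + L ^ (k - 1))"
    using D L by (intro mult_left_mono) (auto simp: max_def)
  finally have main: "(1 + ln (max 1 q)) ^ (k - 1) \<le> (2 * D) ^ (k - 1) * (1 + L ^ (k - 1))" .
  have "\<Psi> * log_tail \<alpha> k (x / (2 * t)) ((R * exp 1) ^ k * \<Psi>)
      = (2 / x) powr \<alpha> * H * (1 + ln (max 1 q)) ^ (k - 1)"
    by (simp add: log_tail_def q_def y H)
  also have "\<dots> \<le> (2 / x) powr \<alpha> * H * ((2 * D) ^ (k - 1) * (1 + L ^ (k - 1)))"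
    using main by (rule mult_left_mono) (simp add: H_def)
  finally show ?thesis by (simp add: D_def L_def H_def mult_ac)
qed

text \<open>The \<open>L ln L\<close> integrand increases with \<open>z\<close> and is infinite where \<open>z\<close> is, hence the value \<open>t\<close> of a
simple function below \<open>z\<close> may be replaced by \<open>z\<close>.\<close>

lemma ennreal_log_tail_le_L_ln_L:
  fixes \<alpha> R x t \<Psi> :: real and k :: nat and z :: ennreal
  assumes "0 < \<alpha>" "1 \<le> R" "2 \<le> x" "0 < t" "0 < \<Psi>" and tz: "ennreal t \<le> z"
  defines "H \<equiv> z * ennreal_powr (ennreal \<Psi>) (1 / \<alpha>)"
  shows "ennreal (\<Psi> * log_tail \<alpha> k (x / (2 * t)) ((R * exp 1) ^ k * \<Psi>))
    \<le> ennreal ((2 * (1 + real k + real k * ln R + \<alpha>)) ^ (k - 1) * (2 / x) powr \<alpha>)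
        * (ennreal_powr H \<alpha> * (1 + ln_plus H ^ (k - 1)))"
    (is "_ \<le> ennreal ?C * _")
proof -
  have "0 \<le> ln R" using assms by simp
  then have C: "0 < ?C"
    using assms by (intro mult_pos_pos zero_less_power) (auto intro!: add_pos_nonneg)
  define h where "h = t * \<Psi> powr (1 / \<alpha>)"
  have h: "0 < h" using assms by (simp add: h_def)
  have "ennreal h = ennreal t * ennreal_powr (ennreal \<Psi>) (1 / \<alpha>)"
    using assms by (simp add: h_def ennreal_powr_def ennreal_mult)
  also have "\<dots> \<le> H" unfolding H_def using tz by (rule mult_right_mono) simp
  finally have hH: "ennreal h \<le> H" .
  show ?thesis
  proof (cases H)
    case (real r)
    then have "h \<le> r" using hH by simp
    have "\<Psi> * log_tail \<alpha> k (x / (2 * t)) ((R * exp 1) ^ k * \<Psi>)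
        \<le> ?C * (h powr \<alpha> * (1 + ln (max h 1) ^ (k - 1)))"
      unfolding h_def using assms by (intro log_tail_le_L_ln_L)
    also have "\<dots> \<le> ?C * (r powr \<alpha> * (1 + ln (max r 1) ^ (k - 1)))"
    proof (intro mult_left_mono mult_mono add_left_mono power_mono)
      show "h powr \<alpha> \<le> r powr \<alpha>" using \<open>h \<le> r\<close> h assms(1) by (intro powr_mono2) auto
      show "ln (max h 1) \<le> ln (max r 1)" using \<open>h \<le> r\<close> by (intro ln_mono) auto
    qed (use C in auto)
    finally have "ennreal (\<Psi> * log_tail \<alpha> k (x / (2 * t)) ((R * exp 1) ^ k * \<Psi>))
        \<le> ennreal (?C * (r powr \<alpha> * (1 + ln (max r 1) ^ (k - 1))))"
      by (rule ennreal_leI)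
    also have "\<dots> = ennreal ?C * (ennreal (r powr \<alpha>) * (1 + ennreal (ln (max r 1)) ^ (k - 1)))"
      using C by (simp add: ennreal_mult ennreal_power ennreal_plus)
    also have "\<dots> = ennreal ?C * (ennreal_powr H \<alpha> * (1 + ln_plus H ^ (k - 1)))"
      using real by (simp add: ennreal_powr_def ln_plus_def)
    finally show ?thesis .
  next
    case top
    have "ennreal c * \<infinity> = \<infinity>" if "0 < c" for c
      using that by (simp add: ennreal_mult_top)
    moreover have "ennreal_powr H \<alpha> * (1 + ln_plus H ^ (k - 1)) = \<infinity>"
      using top by (simp add: ennreal_powr_def ennreal_top_mult)
    ultimately have "ennreal ?C * (ennreal_powr H \<alpha> * (1 + ln_plus H ^ (k - 1))) = \<infinity>"
      using C by presburger
    then show ?thesis by (simp only: infinity_ennreal_def top_greatest)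
  qed
qed

lemma borel_measurable_ln_plus: "ln_plus \<in> borel_measurable borel"
  unfolding ln_plus_def[abs_def] by measurable

context frechet_density
begin

definition normalized_kernel :: "nat \<Rightarrow> ((nat \<Rightarrow> 'e) \<Rightarrow> ennreal) \<Rightarrow> (nat \<Rightarrow> 'e) \<Rightarrow> ennreal" where
  "normalized_kernel k f u = f u * ennreal_powr (ennreal (\<Prod>i<k. g (u i))) (1 / \<alpha>)"

text \<open>Here the density enters: integrating the weight against the power of \<open>\<mu>\<close> is integrating its multiple
by the product of the \<open>g (u i)\<close> against the power of \<open>m\<close>. The bound depends on the simple function
only through its being below \<open>f\<close>.\<close>

lemma emeasure_simple_extremal_integral_le_L_ln_L:
  assumes iso: "borel_isomorphic_to_unit_subset \<mu>" and "0 < k"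
    and Y: "product_sup_measure P \<mu> \<alpha> k X Y"
    and f: "f \<in> borel_measurable (power_measure k \<mu>)"
    and S: "simple_data k \<mu> N a A"
    and le: "AE u in power_measure k \<mu>. simple_function_of N a A u \<le> f u"
    and R: "1 \<le> R" and x: "2 \<le> x"
  shows "emeasure P {w \<in> space P. w \<in> good R \<and> ennreal x < simple_extremal_integral Y N a A w}
      \<le> ennreal ((2 * (1 + real k + real k * ln R + \<alpha>)) ^ (k - 1) * (2 / x) powr \<alpha>) * L_ln_L \<alpha> k (normalized_kernel k f) m"
proof -
  interpret m: prob_space m by (rule prob_m)
  let ?c = "ennreal ((2 * (1 + real k + real k * ln R + \<alpha>)) ^ (k - 1) * (2 / x) powr \<alpha>)"
  let ?s = "\<lambda>u. \<Sum>i<N. ennreal (weight k (x / (2 * a i)) R u) * indicator (A i) u"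
  let ?G = "\<lambda>u. \<Prod>i<k. ennreal (g (u i))"
  let ?h = "\<lambda>u. ennreal_powr (normalized_kernel k f u) \<alpha> * (1 + ln_plus (normalized_kernel k f u) ^ (k - 1))"
  have G: "?G u = ennreal (\<Prod>i<k. g (u i))" and Gpos: "0 < (\<Prod>i<k. g (u i))" for u
    using g_pos by (auto intro!: prod_ennreal prod_pos less_imp_le)
  have sets: "sets (power_measure k m) = sets (power_measure k \<mu>)"
    by (intro sets_PiM_cong) (simp_all add: sets_m)
  have bm: "borel_measurable (power_measure k m) = borel_measurable (power_measure k \<mu>)"
    by (rule measurable_cong_sets[OF sets refl])
  have a: "\<And>i. i < N \<Longrightarrow> 0 < a i" and A: "\<And>i. i < N \<Longrightarrow> A i \<in> sets (power_measure k \<mu>)"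
    and disj: "disjoint_family_on A {..<N}"
    using S sets_power_measure_if_off_diagonal[OF iso] by (auto simp: simple_data_def)
  have gm: "(\<lambda>u. \<Prod>i<k. g (u i)) \<in> borel_measurable (power_measure k \<mu>)" by measurable
  have Gm: "?G \<in> borel_measurable (power_measure k m)"
    unfolding bm G using gm by measurable
  have dens: "power_measure k \<mu> = density (power_measure k m) ?G"
  proof -
    have "sigma_finite_measure (density m (\<lambda>x. ennreal (g x)))"
      unfolding density_g by (rule sigma_finite_mu)
    moreover have "(\<lambda>x. ennreal (g x)) \<in> borel_measurable m" using g_measurable_m by measurable
    ultimately have "power_measure k (density m (\<lambda>x. ennreal (g x))) = density (power_measure k m) ?G"
      by (intro power_measure_density m.sigma_finite_measure_axioms)
    then show ?thesis unfolding density_g .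
  qed
  have sm: "?s \<in> borel_measurable (power_measure k m)"
    unfolding bm
  proof (rule borel_measurable_sum)
    fix i assume "i \<in> {..<N}"
    then have "A i \<in> sets (power_measure k \<mu>)" using A by simp
    then show "(\<lambda>u. ennreal (weight k (x / (2 * a i)) R u) * indicator (A i) u)
        \<in> borel_measurable (power_measure k \<mu>)"
      by measurable
  qed
  have hn: "normalized_kernel k f \<in> borel_measurable (power_measure k m)"
    unfolding bm normalized_kernel_def[abs_def]
    by (intro borel_measurable_times_ennreal f measurable_compose[OF _ borel_measurable_ennreal_powr]
        measurable_compose[OF gm measurable_ennreal])
  have hm: "?h \<in> borel_measurable (power_measure k m)"
    by (intro borel_measurable_times_ennreal borel_measurable_add borel_measurable_const
        borel_measurable_power_ennreal measurable_compose[OF hn borel_measurable_ennreal_powr]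
        measurable_compose[OF hn borel_measurable_ln_plus])
  have "AE u in density (power_measure k m) ?G. simple_function_of N a A u \<le> f u"
    using le unfolding dens .
  then have "AE u in power_measure k m. 0 < ?G u \<longrightarrow> simple_function_of N a A u \<le> f u"
    using Gm by (simp add: AE_density)
  then have AEle: "AE u in power_measure k m. simple_function_of N a A u \<le> f u"
    using Gpos by (simp add: G)
  have "emeasure P {w \<in> space P. w \<in> good R \<and> ennreal x < simple_extremal_integral Y N a A w}
      \<le> (\<integral>\<^sup>+ u. ?s u \<partial>power_measure k \<mu>)"
    using R x by (intro emeasure_simple_extremal_integral_le[OF iso \<open>0 < k\<close> Y S]) auto
  also have "\<dots> = (\<integral>\<^sup>+ u. ?G u * ?s u \<partial>power_measure k m)"
    unfolding dens using Gm sm by (rule nn_integral_density)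
  also have "\<dots> \<le> (\<integral>\<^sup>+ u. ?c * ?h u \<partial>power_measure k m)"
  proof (rule nn_integral_mono_AE)
    show "AE u in power_measure k m. ?G u * ?s u \<le> ?c * ?h u"
      using AEle
    proof eventually_elim
      case (elim u)
      show ?case
      proof (cases "\<exists>i<N. u \<in> A i")
        case True
        then obtain i where i: "i < N" "u \<in> A i" by auto
        have "ennreal (a i) \<le> f u"
          using elim sum_disjoint_indicator[OF disj i, of "\<lambda>i. ennreal (a i)"]
          by (simp add: simple_function_of_def)
        then have "ennreal ((\<Prod>i<k. g (u i)) * weight k (x / (2 * a i)) R u) \<le> ?c * ?h u"
          unfolding weight_def normalized_kernel_def using a[OF i(1)] R x Gpos alpha_pos
          by (intro ennreal_log_tail_le_L_ln_L)
        moreover have "?G u * ?s u = ennreal ((\<Prod>i<k. g (u i)) * weight k (x / (2 * a i)) R u)"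
          unfolding sum_disjoint_indicator[OF disj i] G using Gpos[of u]
          by (simp add: ennreal_mult weight_def log_tail_nonneg)
        ultimately show ?thesis by simp
      next
        case False
        then have "?s u = 0" by (intro sum.neutral) auto
        then show ?thesis by simp
      qed
    qed
  qed
  also have "\<dots> = ?c * (\<integral>\<^sup>+ u. ?h u \<partial>power_measure k m)"
    using hm by (rule nn_integral_cmult)
  finally show ?thesis by (simp add: L_ln_L_def)
qed

text \<open>Where the integral is infinite, the integrals of the approximating simple functions eventually exceed
every level \<open>x\<close>. On \<open>good R\<close> this has probability \<open>O(x\<^sup>-\<^sup>\<alpha>)\<close>, hence zero, and \<open>good R\<close> has
probability at least \<open>1 - 1 / R\<close>.\<close>

lemma AE_multiple_extremal_integral_finite:
  assumes iso: "borel_isomorphic_to_unit_subset \<mu>" and "0 < k"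
    and Y: "product_sup_measure P \<mu> \<alpha> k X Y"
    and f: "f \<in> borel_measurable (power_measure k \<mu>)"
    and I: "multiple_extremal_integral P \<mu> k Y f I"
    and fin: "L_ln_L \<alpha> k (normalized_kernel k f) m < \<infinity>"
  shows "AE w in P. I w < \<infinity>"
proof -
  obtain N a A where Im: "I \<in> borel_measurable P"
    and S: "\<forall>n. simple_data k \<mu> (N n) (a n) (A n)"
    and mono: "\<forall>n u. simple_function_of (N n) (a n) (A n) u
                 \<le> simple_function_of (N (Suc n)) (a (Suc n)) (A (Suc n)) u"
    and lim: "AE u in power_measure k \<mu>. (\<lambda>n. simple_function_of (N n) (a n) (A n) u) \<longlonglongrightarrow> f u"
    and Ilim: "AE w in P. (\<lambda>n. simple_extremal_integral Y (N n) (a n) (A n) w) \<longlonglongrightarrow> I w"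
    using I unfolding multiple_extremal_integral_def by (elim exE conjE) (rule that, assumption+)
  have S: "simple_data k \<mu> (N n) (a n) (A n)" for n using S ..
  let ?J = "\<lambda>n. simple_extremal_integral Y (N n) (a n) (A n)"
  have fle: "AE u in power_measure k \<mu>. simple_function_of (N n) (a n) (A n) u \<le> f u" for n
    using lim
  proof eventually_elim
    case (elim u)
    have "incseq (\<lambda>n. simple_function_of (N n) (a n) (A n) u)"
      using mono by (intro incseq_SucI) simp
    then show ?case using elim by (rule incseq_le)
  qed
  have Jm: "?J n \<in> borel_measurable P" for n
  proof -
    have "Y (A n i) \<in> borel_measurable P" if "i < N n" for i
      using S[of n] that by (intro product_sup_measure_measurable[OF Y]) (simp add: simple_data_def)
    then show ?thesis
      unfolding simple_extremal_integral_def[abs_def]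
      by (intro borel_measurable_SUP borel_measurable_times_ennreal borel_measurable_const) auto
  qed
  have inf_m: "{w \<in> space P. I w = \<infinity>} \<in> sets P" using Im by measurable
  define l where "l = enn2real (L_ln_L \<alpha> k (normalized_kernel k f) m)"
  have l: "L_ln_L \<alpha> k (normalized_kernel k f) m = ennreal l" "0 \<le> l"
    using fin by (simp_all add: l_def less_top)
  have null: "emeasure P {w \<in> space P. w \<in> good R \<and> I w = \<infinity>} = 0" if R: "1 \<le> R" for R
  proof -
    let ?C = "(2 * (1 + real k + real k * ln R + \<alpha>)) ^ (k - 1)"
    have C: "0 \<le> ?C"
      using R alpha_pos by (intro zero_le_power mult_nonneg_nonneg add_nonneg_nonneg) auto
    have bound: "emeasure P {w \<in> space P. w \<in> good R \<and> I w = \<infinity>}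
        \<le> ennreal (?C * (2 / x) powr \<alpha>) * ennreal l" (is "_ \<le> ?b") if x: "2 \<le> x" for x
    proof -
      define T where "T n0 = {w \<in> space P. w \<in> good R \<and> (\<forall>n. n0 \<le> n \<longrightarrow> ennreal x < ?J n w)}" for n0
      have "{w \<in> space P. ennreal x < ?J n w} \<in> sets P" for n using Jm[of n] by measurable
      then have "{w \<in> space P. \<forall>n. n0 \<le> n \<longrightarrow> ennreal x < ?J n w} \<in> sets P" for n0
        by (intro sets.sets_Collect_countable_All sets.sets_Collect_imp sets.sets_Collect_const)
      moreover have "T n0 = good R \<inter> {w \<in> space P. \<forall>n. n0 \<le> n \<longrightarrow> ennreal x < ?J n w}" for n0
        unfolding T_def by auto
      ultimately have Tm: "T n0 \<in> sets P" for n0 by (simp only: sets.Int sets_good)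
      have "AE w in P. w \<in> {w \<in> space P. w \<in> good R \<and> I w = \<infinity>} \<longrightarrow> w \<in> (\<Union>n0. T n0)"
        using Ilim
      proof eventually_elim
        case (elim w)
        show ?case
        proof
          assume w: "w \<in> {w \<in> space P. w \<in> good R \<and> I w = \<infinity>}"
          then have "ennreal x < I w" by simp
          then have "\<forall>\<^sub>F n in sequentially. ennreal x < ?J n w"
            by (rule order_tendstoD(1)[OF elim])
          then obtain n0 where "\<forall>n\<ge>n0. ennreal x < ?J n w"
            unfolding eventually_sequentially by blast
          then have "w \<in> T n0" using w by (simp add: T_def)
          then show "w \<in> (\<Union>n0. T n0)" by blast
        qed
      qed
      then have "emeasure P {w \<in> space P. w \<in> good R \<and> I w = \<infinity>} \<le> emeasure P (\<Union>n0. T n0)"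
        using Tm by (intro emeasure_mono_AE) auto
      also have "\<dots> \<le> ?b"
      proof (rule emeasure_UN_incseq_le[OF _ Tm])
        show "incseq T" unfolding T_def by (rule incseq_SucI) auto
        fix n0
        have "T n0 \<subseteq> {w \<in> space P. w \<in> good R \<and> ennreal x < ?J n0 w}"
          unfolding T_def by auto
        moreover have "{w \<in> space P. w \<in> good R \<and> ennreal x < ?J n0 w} \<in> sets P"
        proof -
          have "{w \<in> space P. ennreal x < ?J n0 w} \<in> sets P" using Jm[of n0] by measurable
          then have "good R \<inter> {w \<in> space P. ennreal x < ?J n0 w} \<in> sets P"
            by (simp only: sets.Int sets_good)
          also have "good R \<inter> {w \<in> space P. ennreal x < ?J n0 w}
              = {w \<in> space P. w \<in> good R \<and> ennreal x < ?J n0 w}" by auto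
          finally show ?thesis .
        qed
        ultimately have "emeasure P (T n0) \<le> emeasure P {w \<in> space P. w \<in> good R \<and> ennreal x < ?J n0 w}"
          by (rule emeasure_mono)
        also have "\<dots> \<le> ?b"
          unfolding l(1)[symmetric]
          by (rule emeasure_simple_extremal_integral_le_L_ln_L[OF iso \<open>0 < k\<close> Y f S fle R x])
        finally show "emeasure P (T n0) \<le> ?b" .
      qed
      finally show ?thesis .
    qed
    have "filterlim (\<lambda>n. real (Suc (Suc n))) at_top sequentially"
      by (intro filterlim_compose[OF filterlim_real_sequentially] filterlim_compose[OF filterlim_Suc] filterlim_Suc)
    then have "(\<lambda>n. real (Suc (Suc n)) powr (- \<alpha>)) \<longlonglongrightarrow> 0"
      using alpha_pos by (intro tendsto_neg_powr) auto
    then have "(\<lambda>n. ?C * 2 powr \<alpha> * l * real (Suc (Suc n)) powr (- \<alpha>)) \<longlonglongrightarrow> 0"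
      by (rule tendsto_mult_right_zero)
    then have "(\<lambda>n. ennreal (?C * 2 powr \<alpha> * l * real (Suc (Suc n)) powr (- \<alpha>))) \<longlonglongrightarrow> ennreal 0"
      by (rule tendsto_ennrealI)
    moreover have "emeasure P {w \<in> space P. w \<in> good R \<and> I w = \<infinity>}
        \<le> ennreal (?C * 2 powr \<alpha> * l * real (Suc (Suc n)) powr (- \<alpha>))" for n
    proof -
      have "emeasure P {w \<in> space P. w \<in> good R \<and> I w = \<infinity>}
          \<le> ennreal (?C * (2 / real (Suc (Suc n))) powr \<alpha>) * ennreal l"
        by (rule bound) simp
      also have "\<dots> = ennreal (?C * (2 / real (Suc (Suc n))) powr \<alpha> * l)"
        by (rule ennreal_mult[symmetric, OF mult_nonneg_nonneg[OF C powr_ge_zero] l(2)])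
      also have "(2 / real (Suc (Suc n))) powr \<alpha> = 2 powr \<alpha> * real (Suc (Suc n)) powr (- \<alpha>)"
        by (simp add: powr_divide powr_minus_divide)
      finally show ?thesis by (simp only: mult_ac)
    qed
    ultimately have "emeasure P {w \<in> space P. w \<in> good R \<and> I w = \<infinity>} \<le> ennreal 0"
      by (intro LIMSEQ_le_const) auto
    then show ?thesis by simp
  qed
  have "emeasure P {w \<in> space P. I w = \<infinity>} \<le> ennreal (inverse (real (Suc n)))" for n
  proof -
    let ?R = "real (Suc n)"
    have m1: "{w \<in> space P. w \<in> good ?R \<and> I w = \<infinity>} \<in> sets P"
    proof -
      have "good ?R \<inter> {w \<in> space P. I w = \<infinity>} \<in> sets P"
        using inf_m by (simp only: sets.Int sets_good)
      also have "good ?R \<inter> {w \<in> space P. I w = \<infinity>} = {w \<in> space P. w \<in> good ?R \<and> I w = \<infinity>}" by auto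
      finally show ?thesis .
    qed
    have "emeasure P {w \<in> space P. I w = \<infinity>}
        \<le> emeasure P ({w \<in> space P. w \<in> good ?R \<and> I w = \<infinity>} \<union> (space P - good ?R))"
      using m1 sets_good by (intro emeasure_mono) auto
    also have "\<dots> \<le> emeasure P {w \<in> space P. w \<in> good ?R \<and> I w = \<infinity>} + emeasure P (space P - good ?R)"
      using m1 sets_good by (intro emeasure_subadditive) auto
    also have "\<dots> \<le> 0 + ennreal (1 / ?R)"
    proof (rule add_mono)
      show "emeasure P {w \<in> space P. w \<in> good ?R \<and> I w = \<infinity>} \<le> 0"
        by (rule eq_refl, rule null) simp
      show "emeasure P (space P - good ?R) \<le> ennreal (1 / ?R)"
        by (rule emeasure_not_good) simp
    qed
    finally show ?thesis by (simp add: inverse_eq_divide)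
  qed
  moreover have "(\<lambda>n. ennreal (inverse (real (Suc n)))) \<longlonglongrightarrow> ennreal 0"
    by (rule tendsto_ennrealI[OF LIMSEQ_inverse_real_of_nat])
  ultimately have "emeasure P {w \<in> space P. I w = \<infinity>} \<le> ennreal 0"
    by (intro LIMSEQ_le_const) auto
  then have "emeasure P {w \<in> space P. I w = \<infinity>} = 0" by simp
  then show ?thesis
    using inf_m by (subst AE_iff_measurable[OF _ refl]) (auto simp: less_top[symmetric])
qed

end

theorem theorem3p3:
  fixes P :: "'w measure" and \<mu> :: "'e measure" and \<alpha> :: real and k :: nat
    and X :: "'e set \<Rightarrow> 'w \<Rightarrow> ennreal"
    and Y :: "(nat \<Rightarrow> 'e) set \<Rightarrow> 'w \<Rightarrow> ennreal"
    and f :: "(nat \<Rightarrow> 'e) \<Rightarrow> ennreal"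
    and I :: "'w \<Rightarrow> ennreal"
  assumes "prob_space P"
    and "borel_isomorphic_to_unit_subset \<mu>"
    and "sigma_finite_measure \<mu>"
    and "emeasure \<mu> (space \<mu>) \<noteq> 0"
    and "0 < \<alpha>"
    and "frechet_sup_measure P \<mu> \<alpha> X"
    and "2 \<le> k"
    and "product_sup_measure P \<mu> \<alpha> k X Y"
    and "f \<in> class_L k \<mu>"
    and "multiple_extremal_integral P \<mu> k Y f I"
    and "\<exists>m \<psi>. prob_space m \<and> sets m = sets \<mu> \<and>
           absolutely_continuous m \<mu> \<and> absolutely_continuous \<mu> m \<and>
           \<psi> \<in> borel_measurable m \<and> density m \<psi> = \<mu> \<and>
           (AE x in m. 0 < \<psi> x \<and> \<psi> x < \<infinity>) \<and>
           L_ln_L \<alpha> k (\<lambda>u. f u * ennreal_powr (tensor_power k \<psi> u) (1 / \<alpha>)) m < \<infinity>"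
  shows "AE w in P. I w < \<infinity>"
proof -
  obtain m and \<psi> :: "'e \<Rightarrow> ennreal" where m: "prob_space m"
    and \<psi>: "\<psi> \<in> borel_measurable m" "density m \<psi> = \<mu>" "AE x in m. 0 < \<psi> x \<and> \<psi> x < \<infinity>"
    and fin: "L_ln_L \<alpha> k (\<lambda>u. f u * ennreal_powr (tensor_power k \<psi> u) (1 / \<alpha>)) m < \<infinity>"
    using assms(11) by (elim exE conjE) (rule that, assumption+)
  \<comment> \<open>The value on the null set where \<open>\<psi>\<close> vanishes or is infinite is arbitrary but positive.\<close>
  define g where "g x = (if 0 < \<psi> x \<and> \<psi> x < \<infinity> then enn2real (\<psi> x) else 1)" for x
  have g: "g \<in> borel_measurable m" unfolding g_def[abs_def] using \<psi>(1) by measurable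
  have eq: "AE x in m. \<psi> x = ennreal (g x)"
    using \<psi>(3) by eventually_elim (simp add: g_def)
  have "density m (\<lambda>x. ennreal (g x)) = density m \<psi>"
    using \<psi>(1) g eq by (intro density_cong) (auto elim!: eventually_mono)
  then have dens: "density m (\<lambda>x. ennreal (g x)) = \<mu>" using \<psi>(2) by simp
  interpret frechet_density P \<mu> \<alpha> X m g
  proof (intro frechet_density.intro frechet_density_axioms.intro
      frechet_random_sup_measure.intro frechet_random_sup_measure_axioms.intro)
    show "0 < g x" for x by (simp add: g_def enn2real_positive_iff)
  qed (use assms m g dens in auto)
  have "AE u in power_measure k m. \<forall>i\<in>{..<k}. \<psi> (u i) = ennreal (g (u i))"
    using m eq by (intro AE_finite_allI AE_PiM_component) auto
  then have "AE u in power_measure k m.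
      f u * ennreal_powr (tensor_power k \<psi> u) (1 / \<alpha>) = normalized_kernel k f u"
  proof eventually_elim
    case (elim u)
    have "tensor_power k \<psi> u = (\<Prod>i<k. ennreal (g (u i)))"
      unfolding tensor_power_def using elim by (intro prod.cong) auto
    also have "\<dots> = ennreal (\<Prod>i<k. g (u i))" using g_pos by (intro prod_ennreal less_imp_le)
    finally show ?case by (simp add: normalized_kernel_def)
  qed
  then have "L_ln_L \<alpha> k (\<lambda>u. f u * ennreal_powr (tensor_power k \<psi> u) (1 / \<alpha>)) m
      = L_ln_L \<alpha> k (normalized_kernel k f) m"
    unfolding L_ln_L_def by (intro nn_integral_cong_AE) (auto elim!: eventually_mono)
  then have "L_ln_L \<alpha> k (normalized_kernel k f) m < \<infinity>" using fin by simp
  moreover have "f \<in> borel_measurable (power_measure k \<mu>)"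
    using assms(9) by (simp add: class_L_def)
  ultimately show ?thesis
    using assms by (intro AE_multiple_extremal_integral_finite) auto
qed

end
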